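(* Let $0<s<1$, and let $a,b,c\in\mathbb{C}$ with $b\neq0$ and $\operatorname{Im}c>0$ satisfy $$\frac{1-s^2}{4s}=\frac{|b|^2}{4\operatorname{Im}c},\qquad \frac{1+s^2}{4s}=\frac{b^2}{4\operatorname{Im}c}+\frac{a}{2i}.$$ Let $\Phi$, $T$ and $T^\ast$ be the weight, Bargmann-type transform and adjoint determined by $(a,b,c)$. Then $\mathscr{X}_s(\mathbb{C})=\mathscr{H}_\Phi(\mathbb{C})$, and for every $F\in L^2_\Phi(\mathbb{C})$ and $z\in\mathbb{C}$, $$T\circ T^\ast F(z)=\int_{\mathbb{C}}K_s(z,\zeta)F(\zeta)\exp\left(-\frac{1-s^2}{2s}|\zeta|^2+\frac{1+s^2}{4s}(\zeta^2+\bar\zeta^2)\right)L(d\zeta),$$ where $$K_s(z,\zeta)=\frac{1-s^2}{2\pi s}\exp\left(\frac{1-s^2}{2s}z\bar\zeta-\frac{1+s^2}{4s}(z^2+\bar\zeta^2)\right).$$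
   Context: $L(dz)$ is Lebesgue measure on $\mathbb{C}\simeq\mathbb{R}^2$. For $0<s<1$, $\mathscr{X}_s(\mathbb{C})$ is the Hilbert space of all holomorphic functions $\varphi$ on $\mathbb{C}$ with $$\|\varphi\|_s^2=\int_{\mathbb{C}}|\varphi(z)|^2\exp\left(-\frac{1-s^2}{2s}|z|^2+\frac{1+s^2}{4s}(z^2+\bar z^2)\right)L(dz)<\infty,$$ with the corresponding weighted $L^2$ inner product. Given $a,b,c\in\mathbb{C}$ with $b\neq0$ and $\operatorname{Im}c>0$, set $\phi(z,x)=\frac a2z^2+bzx+\frac c2x^2$, $C_\phi=2^{-1/2}\pi^{-3/4}|b|(\operatorname{Im}c)^{-1/4}$, and define the Bargmann-type transform $$Tf(z)=C_\phi\int_{\mathbb{R}}e^{i\phi(z,x)}f(x)\,dx,\qquad z\in\mathbb{C}.$$ Set $$\Phi(z)=\frac{|bz|^2}{4\operatorname{Im}c}-\frac{b^2z^2+\bar b^2\bar z^2}{8\operatorname{Im}c}-\frac{az^2-\bar a\bar z^2}{4i}.$$ $L^2_\Phi(\mathbb{C})$ is the Hilbert space of square integrable functions on $\mathbb{C}$ with respect to $e^{-2\Phi(z)}L(dz)$, and $\mathscr{H}_\Phi(\mathbb{C})$ is its closed subspace of holomorphic functions, with inner product $(\varphi,\psi)=\int_{\mathbb{C}}\varphi\bar\psi\,e^{-2\Phi}L(dz)$. It is known that $T$ is a Hilbert space isomorphism of $L^2(\mathbb{R})$ onto $\mathscr{H}_\Phi(\mathbb{C})$. $T^\ast:L^2_\Phi(\mathbb{C})\to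 L^2(\mathbb{R})$ denotes the adjoint of $T:L^2(\mathbb{R})\to L^2_\Phi(\mathbb{C})$, formally given by $$T^\ast F(x)=C_\phi\int_{\mathbb{C}}e^{-i\overline{\phi(z,x)}}F(z)e^{-2\Phi(z)}L(dz),\qquad x\in\mathbb{R}.$$ *)

theory Defs
  imports "HOL-Analysis.Analysis"
begin

text \<open>
  Weighted spaces \<open>L\<^sup>2(w dx)\<close> with respect to Lebesgue measure. Elements are represented by
  functions rather than by classes modulo null sets. Inner products are linear in the first
  argument.
\<close>

definition L2w :: "('a::euclidean_space \<Rightarrow> real) \<Rightarrow> ('a \<Rightarrow> complex) set" where
  "L2w w = {f \<in> borel_measurable lebesgue. integrable lebesgue (\<lambda>x. (cmod (f x))\<^sup>2 * w x)}"

definition innerw :: "('a::euclidean_space \<Rightarrow> real) \<Rightarrow> ('a \<Rightarrow> complex) \<Rightarrow> ('a \<Rightarrow> complex) \<Rightarrow> complex" where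
  "innerw w f g = (\<integral>x. f x * cnj (g x) * complex_of_real (w x) \<partial>lebesgue)"

definition L2_real :: "(real \<Rightarrow> complex) set" where
  "L2_real = L2w (\<lambda>_. 1)"

definition inner_real :: "(real \<Rightarrow> complex) \<Rightarrow> (real \<Rightarrow> complex) \<Rightarrow> complex" where
  "inner_real = innerw (\<lambda>_. 1)"

definition X_weight :: "real \<Rightarrow> complex \<Rightarrow> real" where
  "X_weight s z = exp (- (1 - s\<^sup>2) / (2 * s) * (cmod z)\<^sup>2 + (1 + s\<^sup>2) / (4 * s) * Re (z\<^sup>2 + (cnj z)\<^sup>2))"

lemma of_real_X_weight:
  "complex_of_real (X_weight s z) =
     exp (- complex_of_real ((1 - s\<^sup>2) / (2 * s) * (cmod z)\<^sup>2)
          + complex_of_real ((1 + s\<^sup>2) / (4 * s)) * (z\<^sup>2 + (cnj z)\<^sup>2))"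
proof -
  have "complex_of_real (Re (z\<^sup>2 + (cnj z)\<^sup>2)) = z\<^sup>2 + (cnj z)\<^sup>2"
    by (simp add: complex_eq_iff power2_eq_square)
  then show ?thesis
    unfolding X_weight_def exp_of_real [symmetric] of_real_add
      of_real_mult [of _ "Re (z\<^sup>2 + (cnj z)\<^sup>2)"]
    by (simp only: minus_divide_left [symmetric] mult_minus_left of_real_minus)
qed

definition X_space :: "real \<Rightarrow> (complex \<Rightarrow> complex) set" where
  "X_space s = {\<phi> \<in> L2w (X_weight s). \<phi> holomorphic_on UNIV}"

definition X_inner :: "real \<Rightarrow> (complex \<Rightarrow> complex) \<Rightarrow> (complex \<Rightarrow> complex) \<Rightarrow> complex" where
  "X_inner s = innerw (X_weight s)"

definition phase :: "complex \<Rightarrow> complex \<Rightarrow> complex \<Rightarrow> complex \<Rightarrow> real \<Rightarrow> complex" where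
  "phase a b c z x = a / 2 * z\<^sup>2 + b * z * complex_of_real x + c / 2 * (complex_of_real x)\<^sup>2"

definition C_phase :: "complex \<Rightarrow> complex \<Rightarrow> real" where
  "C_phase b c = 2 powr (- 1 / 2) * pi powr (- 3 / 4) * cmod b * Im c powr (- 1 / 4)"

definition bargmann :: "complex \<Rightarrow> complex \<Rightarrow> complex \<Rightarrow> (real \<Rightarrow> complex) \<Rightarrow> complex \<Rightarrow> complex" where
  "bargmann a b c f z =
     complex_of_real (C_phase b c) * (\<integral>x. exp (\<i> * phase a b c z x) * f x \<partial>lebesgue)"

text \<open>The expression under \<open>Re\<close> below is real-valued, see \<open>of_real_Phi\<close>.\<close>

definition Phi :: "complex \<Rightarrow> complex \<Rightarrow> complex \<Rightarrow> complex \<Rightarrow> real" where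
  "Phi a b c z =
     Re (complex_of_real ((cmod (b * z))\<^sup>2 / (4 * Im c))
         - (b\<^sup>2 * z\<^sup>2 + (cnj b)\<^sup>2 * (cnj z)\<^sup>2) / complex_of_real (8 * Im c)
         - (a * z\<^sup>2 - cnj a * (cnj z)\<^sup>2) / (4 * \<i>))"

lemma of_real_Phi:
  "complex_of_real (Phi a b c z) =
     complex_of_real ((cmod (b * z))\<^sup>2 / (4 * Im c))
       - (b\<^sup>2 * z\<^sup>2 + (cnj b)\<^sup>2 * (cnj z)\<^sup>2) / complex_of_real (8 * Im c)
       - (a * z\<^sup>2 - cnj a * (cnj z)\<^sup>2) / (4 * \<i>)"
proof -
  have *: "complex_of_real (Re w) = w" if "cnj w = w" for w
    using that by (simp add: complex_eq_iff)
  show ?thesis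
    unfolding Phi_def by (rule *) (simp add: algebra_simps diff_divide_distrib)
qed

definition Phi_weight :: "complex \<Rightarrow> complex \<Rightarrow> complex \<Rightarrow> complex \<Rightarrow> real" where
  "Phi_weight a b c z = exp (- 2 * Phi a b c z)"

definition L2_Phi :: "complex \<Rightarrow> complex \<Rightarrow> complex \<Rightarrow> (complex \<Rightarrow> complex) set" where
  "L2_Phi a b c = L2w (Phi_weight a b c)"

definition Phi_inner ::
    "complex \<Rightarrow> complex \<Rightarrow> complex \<Rightarrow> (complex \<Rightarrow> complex) \<Rightarrow> (complex \<Rightarrow> complex) \<Rightarrow> complex" where
  "Phi_inner a b c = innerw (Phi_weight a b c)"

definition H_Phi :: "complex \<Rightarrow> complex \<Rightarrow> complex \<Rightarrow> (complex \<Rightarrow> complex) set" where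
  "H_Phi a b c = {\<phi> \<in> L2_Phi a b c. \<phi> holomorphic_on UNIV}"

text \<open>
  The Hilbert space adjoint of \<open>bargmann a b c\<close> as an operator from \<open>L2_real\<close> to \<open>L2_Phi a b c\<close>.
  The value at \<open>F\<close> is determined up to a null set, which \<open>bargmann a b c\<close> does not see. The
  integral formula \<open>C \<integral> exp (- \<i> cnj (phase z x)) F z exp (- 2 \<Phi> z) dz\<close> is not used as the
  definition since it need not converge absolutely for every \<open>F\<close> in \<open>L2_Phi a b c\<close>.
\<close>

definition bargmann_adj ::
    "complex \<Rightarrow> complex \<Rightarrow> complex \<Rightarrow> (complex \<Rightarrow> complex) \<Rightarrow> real \<Rightarrow> complex" where
  "bargmann_adj a b c F =
     (SOME g. g \<in> L2_real \<and>
        (\<forall>f\<in>L2_real. Phi_inner a b c (bargmann a b c f) F = inner_real f g))"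

definition K_kernel :: "real \<Rightarrow> complex \<Rightarrow> complex \<Rightarrow> complex" where
  "K_kernel s z \<zeta> = complex_of_real ((1 - s\<^sup>2) / (2 * pi * s)) *
     exp (complex_of_real ((1 - s\<^sup>2) / (2 * s)) * z * cnj \<zeta>
          - complex_of_real ((1 + s\<^sup>2) / (4 * s)) * (z\<^sup>2 + (cnj \<zeta>)\<^sup>2))"

end

theory Submission
  imports Defs "HOL-Probability.Characteristic_Functions"
begin

text \<open>
  The two conditions on \<open>(a, b, c)\<close> say exactly that \<open>- 2 \<Phi>\<close> is the exponent of the weight of
  \<open>X_space s\<close>: the first one matches the coefficient of \<open>\<bar>z\<bar>\<^sup>2\<close>, the second one those of \<open>z\<^sup>2\<close> and its
  conjugate. The two spaces and their inner products therefore coincide (\<open>Phi_weight_eq\<close>).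

  For the operator identity put \<open>e z x = C exp (\<i> \<phi>(z, x))\<close>, so that \<open>T f z = \<integral> e z x f x dx\<close>.
  If \<open>g = T\<^sup>* F\<close>, then testing the defining relation \<open>(T f, F) = (f, g)\<close> with \<open>f = cnj (e z \<cdot>)\<close>
  yields \<open>T g z = \<integral> \<langle>e z, e \<zeta>\<rangle> F \<zeta> exp (- 2 \<Phi> \<zeta>) d\<zeta>\<close>, where \<open>\<langle>e z, e \<zeta>\<rangle>\<close> is a Gaussian
  integral over the line; its value is \<open>K\<^sub>s(z, \<zeta>)\<close> (\<open>K_kernel_eq_phase_pairing\<close>).

  What needs an argument is that \<open>T\<close> is bounded from \<open>L\<^sup>2(\<real>)\<close> to \<open>L\<^sup>2\<^sub>\<Phi>\<close> and has an adjoint.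
  After the weight is split evenly between both sides, the Gram kernel \<open>\<langle>e z, e \<zeta>\<rangle> exp (- \<Phi> z - \<Phi> \<zeta>)\<close> has
  modulus \<open>(\<alpha> / \<pi>) exp (- \<alpha> \<bar>z - \<zeta>\<bar>\<^sup>2 / 2)\<close> with \<open>\<alpha> = (1 - s\<^sup>2) / (2 s)\<close>, whose integral over \<open>\<zeta>\<close>
  is \<open>2\<close> for every \<open>z\<close>. Schur's test then bounds \<open>T T\<^sup>*\<close>, hence \<open>T\<^sup>*\<close> on \<open>L\<^sup>1 \<inter> L\<^sup>2\<close>, where it is
  given by an absolutely convergent integral; \<open>T\<close> is bounded by duality, and \<open>T\<^sup>*\<close> extends to
  \<open>L\<^sup>2\<^sub>\<Phi>\<close> along truncations of \<open>F\<close> since \<open>L\<^sup>2(\<real>)\<close> is complete. This part is carried out for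
  arbitrary \<open>\<sigma>\<close>-finite measure spaces in the locale \<open>schur_kernel\<close>; its main results are
  \<open>energy_ker_adj_le\<close>, \<open>square_integrable_ker_op\<close>, \<open>adjoint_exists\<close> and
  \<open>ker_op_eq_gram_integral\<close>.
\<close>

section \<open>Square integrable functions\<close>

definition square_integrable :: "'a measure \<Rightarrow> ('a \<Rightarrow> complex) \<Rightarrow> bool" where
  "square_integrable M f \<longleftrightarrow> f \<in> borel_measurable M \<and> integrable M (\<lambda>x. (cmod (f x))\<^sup>2)"

definition energy :: "'a measure \<Rightarrow> ('a \<Rightarrow> complex) \<Rightarrow> real" where
  "energy M f = (\<integral>x. (cmod (f x))\<^sup>2 \<partial>M)"

lemma square_integrableD [dest]:
  assumes "square_integrable M f"
  shows "f \<in> borel_measurable M" "integrable M (\<lambda>x. (cmod (f x))\<^sup>2)"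
  using assms by (auto simp: square_integrable_def)

lemma energy_nonneg [simp]: "0 \<le> energy M f"
  by (simp add: energy_def)

lemma nn_integral_energy:
  "square_integrable M f \<Longrightarrow> (\<integral>\<^sup>+x. ennreal ((cmod (f x))\<^sup>2) \<partial>M) = ennreal (energy M f)"
  unfolding energy_def by (intro nn_integral_eq_integral) auto

lemma square_integrable_bounded_energy:
  assumes "f \<in> borel_measurable M" "(\<integral>\<^sup>+x. ennreal ((cmod (f x))\<^sup>2) \<partial>M) \<le> ennreal E" "0 \<le> E"
  shows "square_integrable M f" "energy M f \<le> E"
proof -
  show sq: "square_integrable M f"
    unfolding square_integrable_def
  proof
    show "integrable M (\<lambda>x. (cmod (f x))\<^sup>2)"
      by (rule integrableI_bounded)
        (use assms in \<open>auto intro: le_less_trans[OF assms(2)]\<close>)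
  qed fact
  then show "energy M f \<le> E"
    using assms nn_integral_energy[OF sq] by simp
qed

lemma square_integrable_dominated:
  assumes "g \<in> borel_measurable M" "square_integrable M f" "\<And>x. cmod (g x) \<le> cmod (f x)"
  shows "square_integrable M g"
  unfolding square_integrable_def
  by (intro conjI assms(1) Bochner_Integration.integrable_bound[OF square_integrableD(2)[OF assms(2)]])
    (use assms in \<open>auto intro!: power_mono\<close>)

lemma borel_measurable_cnj [measurable]: "cnj \<in> borel_measurable borel"
  by (intro borel_measurable_continuous_onI continuous_intros)

lemma square_integrable_cnj:
  assumes "square_integrable M f"
  shows "square_integrable M (\<lambda>x. cnj (f x))"
proof -
  note [measurable] = square_integrableD(1)[OF assms]
  have "(\<lambda>x. cnj (f x)) \<in> borel_measurable M" by measurable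
  then show ?thesis using assms by (simp add: square_integrable_def)
qed

lemma energy_cnj [simp]: "energy M (\<lambda>x. cnj (f x)) = energy M f"
  by (simp add: energy_def)

lemma cmod_diff_sq_le: "(cmod (u - v))\<^sup>2 \<le> 2 * (cmod u)\<^sup>2 + 2 * (cmod v)\<^sup>2"
proof -
  have "(cmod (u - v))\<^sup>2 \<le> (cmod u + cmod v)\<^sup>2"
    by (intro power_mono norm_triangle_ineq4) auto
  then show ?thesis
    using sum_squares_bound[of "cmod u" "cmod v"] by (simp add: power2_sum)
qed

lemma
  assumes f: "square_integrable M f" and g: "square_integrable M g"
  shows square_integrable_diff: "square_integrable M (\<lambda>x. f x - g x)"
    and energy_diff_le: "energy M (\<lambda>x. f x - g x) \<le> 2 * energy M f + 2 * energy M g"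
proof -
  note [measurable] = square_integrableD[OF f] square_integrableD[OF g]
  have major: "integrable M (\<lambda>x. 2 * (cmod (f x))\<^sup>2 + 2 * (cmod (g x))\<^sup>2)"
    by (intro Bochner_Integration.integrable_add integrable_mult_right square_integrableD f g)
  show sq: "square_integrable M (\<lambda>x. f x - g x)"
    unfolding square_integrable_def
  proof
    show "integrable M (\<lambda>x. (cmod (f x - g x))\<^sup>2)"
      by (rule Bochner_Integration.integrable_bound[of _ "\<lambda>x. 2 * (cmod (f x))\<^sup>2 + 2 * (cmod (g x))\<^sup>2"])
        (use major cmod_diff_sq_le in auto)
  qed auto
  have "energy M (\<lambda>x. f x - g x) \<le> (\<integral>x. 2 * (cmod (f x))\<^sup>2 + 2 * (cmod (g x))\<^sup>2 \<partial>M)"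
    unfolding energy_def by (intro integral_mono) (use sq major cmod_diff_sq_le in auto)
  then show "energy M (\<lambda>x. f x - g x) \<le> 2 * energy M f + 2 * energy M g"
    using Bochner_Integration.integral_add[OF integrable_mult_right[of 2, OF square_integrableD(2)[OF f]]
        integrable_mult_right[of 2, OF square_integrableD(2)[OF g]]]
    by (simp add: energy_def)
qed

lemma integrable_mult_square_integrable:
  assumes f: "square_integrable M f" and g: "square_integrable M g"
  shows "integrable M (\<lambda>x. f x * g x)"
proof (rule Bochner_Integration.integrable_bound)
  note [measurable] = square_integrableD(1)[OF f] square_integrableD(1)[OF g]
  show "integrable M (\<lambda>x. (cmod (f x))\<^sup>2 + (cmod (g x))\<^sup>2)"
    using f g by auto
  show "(\<lambda>x. f x * g x) \<in> borel_measurable M" by measurable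
  have "cmod u * cmod v \<le> (cmod u)\<^sup>2 + (cmod v)\<^sup>2" for u v
    using sum_squares_bound[of "cmod u" "cmod v"] mult_nonneg_nonneg[OF norm_ge_zero[of u] norm_ge_zero[of v]]
    unfolding mult.assoc by linarith
  then show "AE x in M. norm (f x * g x) \<le> norm ((cmod (f x))\<^sup>2 + (cmod (g x))\<^sup>2)"
    by (simp add: norm_mult)
qed

lemma Cauchy_Schwarz_abs_integral:
  assumes f: "square_integrable M f" and g: "square_integrable M g"
  shows "(\<integral>x. cmod (f x * g x) \<partial>M)\<^sup>2 \<le> energy M f * energy M g"
proof -
  note [measurable] = square_integrableD(1)[OF f] square_integrableD(1)[OF g]
  have "ennreal (\<integral>x. cmod (f x * g x) \<partial>M) = (\<integral>\<^sup>+x. ennreal (cmod (f x)) * ennreal (cmod (g x)) \<partial>M)"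
    using integrable_norm[OF integrable_mult_square_integrable[OF f g]]
    by (subst nn_integral_eq_integral[symmetric]) (auto simp: norm_mult ennreal_mult)
  then have "(ennreal (\<integral>x. cmod (f x * g x) \<partial>M))\<^sup>2 \<le>
      (\<integral>\<^sup>+x. (ennreal (cmod (f x)))\<^sup>2 \<partial>M) * (\<integral>\<^sup>+x. (ennreal (cmod (g x)))\<^sup>2 \<partial>M)"
    by (simp only:) (rule Cauchy_Schwarz_nn_integral; measurable)
  also have "\<dots> = ennreal (energy M f * energy M g)"
    by (simp add: ennreal_power nn_integral_energy f g ennreal_mult)
  finally show ?thesis
    by (subst (asm) ennreal_power) auto
qed

lemma Cauchy_Schwarz_integral:
  assumes f: "square_integrable M f" and g: "square_integrable M g"
  shows "(cmod (\<integral>x. f x * g x \<partial>M))\<^sup>2 \<le> energy M f * energy M g"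
  by (rule order_trans[OF power_mono Cauchy_Schwarz_abs_integral[OF f g]])
    (auto intro: integral_norm_bound)

lemma integral_mult_cnj_self:
  "(\<integral>x. f x * cnj (f x) \<partial>M) = complex_of_real (energy M f)"
  unfolding energy_def complex_norm_square[symmetric] by (rule integral_complex_of_real)

text \<open>
  The Cauchy-Schwarz inequality bounds \<open>\<parallel>u\<parallel>\<^sup>2 = (u, v)\<close> by \<open>\<parallel>u\<parallel> \<parallel>v\<parallel>\<close>, and one factor
  \<open>\<parallel>u\<parallel>\<close> cancels. It turns an identity in weak form into a norm bound.
\<close>

lemma energy_le_of_self_pairing:
  assumes u: "square_integrable M u" and v: "square_integrable M v"
    and eq: "(\<integral>x. u x * cnj (u x) \<partial>M) = (\<integral>x. u x * cnj (v x) \<partial>M)"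
  shows "energy M u \<le> energy M v"
proof (cases "energy M u = 0")
  case False
  have "(energy M u)\<^sup>2 \<le> energy M u * energy M v"
    using Cauchy_Schwarz_integral[OF u square_integrable_cnj[OF v]]
    by (simp add: eq[symmetric] integral_mult_cnj_self)
  moreover have "0 < energy M u" using False energy_nonneg[of M u] by linarith
  ultimately show ?thesis by (simp add: power2_eq_square)
qed simp

lemma norm_integral_le_nn_integral:
  fixes f :: "'a \<Rightarrow> 'b::{banach, second_countable_topology}"
  shows "ennreal (norm (\<integral>x. f x \<partial>M)) \<le> (\<integral>\<^sup>+x. ennreal (norm (f x)) \<partial>M)"
  by (cases "integrable M f") (auto simp: integral_norm_bound_ennreal not_integrable_integral_eq)

text \<open>
  The part of the completeness of \<open>L\<^sup>2\<close> that the construction of adjoints needs. The increments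
  \<open>d n = g (n + 1) - g n\<close> decay so fast that \<open>S = \<Sum>n. 4^n \<bar>d n\<bar>\<^sup>2\<close> is still integrable. Where \<open>S\<close>
  is finite, \<open>\<bar>d n\<bar> \<le> \<surd>S / 2^n\<close>, so \<open>g n\<close> converges pointwise and is dominated by
  \<open>\<bar>g 0\<bar> + 2 \<surd>S\<close>, which is square integrable; pairings converge by dominated convergence.
\<close>

lemma weak_limit_of_fast_Cauchy:
  assumes g: "\<And>n. square_integrable M (g n)"
    and fast: "\<And>n. energy M (\<lambda>x. g (Suc n) x - g n x) \<le> C / 16 ^ n"
  shows "\<exists>h. square_integrable M h \<and>
    (\<forall>f. square_integrable M f \<longrightarrow>
      (\<lambda>n. \<integral>x. f x * cnj (g n x) \<partial>M) \<longlonglongrightarrow> (\<integral>x. f x * cnj (h x) \<partial>M))"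
proof -
  define d where "d n x = g (Suc n) x - g n x" for n x
  define S where "S x = (\<Sum>n. ennreal (4 ^ n * (cmod (d n x))\<^sup>2))" for x
  define R where "R x = enn2real (S x)" for x
  have gm [measurable]: "g n \<in> borel_measurable M" for n
    using g by auto
  have dm [measurable]: "d n \<in> borel_measurable M" for n
    unfolding d_def by measurable
  have Sm [measurable]: "S \<in> borel_measurable M" "R \<in> borel_measurable M"
    unfolding S_def R_def by measurable
  have dsq: "square_integrable M (d n)" for n
    unfolding d_def by (intro square_integrable_diff g)
  have C: "0 \<le> C"
    using order_trans[OF energy_nonneg fast[of 0]] by simp
  have "(\<integral>\<^sup>+x. S x \<partial>M) = (\<Sum>n. \<integral>\<^sup>+x. ennreal (4 ^ n * (cmod (d n x))\<^sup>2) \<partial>M)"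
    unfolding S_def by (rule nn_integral_suminf) measurable
  also have "\<dots> \<le> (\<Sum>n. ennreal (C * (1/4) ^ n))"
  proof (intro suminf_le)
    fix n
    have "(\<integral>\<^sup>+x. ennreal (4 ^ n * (cmod (d n x))\<^sup>2) \<partial>M) = ennreal (4 ^ n * energy M (d n))"
      using nn_integral_energy[OF dsq, of n] by (simp add: ennreal_mult nn_integral_cmult)
    also have "\<dots> \<le> ennreal (4 ^ n * (C / 16 ^ n))"
      using fast[of n] by (intro ennreal_leI mult_left_mono) (auto simp: d_def[abs_def])
    also have "(4::real) ^ n * (C / 16 ^ n) = C * (1/4) ^ n"
    proof -
      have "(16::real) ^ n = 4 ^ n * 4 ^ n" by (simp flip: power_mult_distrib)
      then show ?thesis by (simp add: field_simps power_divide)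
    qed
    finally show "(\<integral>\<^sup>+x. ennreal (4 ^ n * (cmod (d n x))\<^sup>2) \<partial>M) \<le> ennreal (C * (1/4) ^ n)" .
  qed auto
  also have "\<dots> = ennreal (\<Sum>n. C * (1/4) ^ n)"
    using C by (intro suminf_ennreal2) (auto intro!: summable_mult summable_geometric)
  finally have S_int: "(\<integral>\<^sup>+x. S x \<partial>M) < \<infinity>"
    by (rule le_less_trans) simp
  then have S_fin: "AE x in M. S x \<noteq> \<infinity>"
    by (intro nn_integral_PInf_AE) auto
  have R_int: "integrable M R"
  proof (rule integrableI_bounded)
    have "(\<integral>\<^sup>+x. ennreal (norm (R x)) \<partial>M) = (\<integral>\<^sup>+x. S x \<partial>M)"
      by (rule nn_integral_cong_AE)
        (use S_fin in \<open>auto elim!: eventually_mono simp: R_def ennreal_enn2real_if\<close>)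
    then show "(\<integral>\<^sup>+x. ennreal (norm (R x)) \<partial>M) < \<infinity>" using S_int by (simp only:)
  qed (rule Sm(2))
  have d_le: "cmod (d n x) \<le> sqrt (R x) * (1/2) ^ n" if "S x \<noteq> \<infinity>" for n x
  proof -
    have "ennreal (4 ^ n * (cmod (d n x))\<^sup>2) \<le> S x"
    proof -
      have "(\<Sum>j\<in>{n}. ennreal (4 ^ j * (cmod (d j x))\<^sup>2)) \<le> S x"
        unfolding S_def by (rule sum_le_suminf) auto
      then show ?thesis by simp
    qed
    also have "S x = ennreal (R x)"
      unfolding R_def using that by (simp add: ennreal_enn2real_if)
    finally have "4 ^ n * (cmod (d n x))\<^sup>2 \<le> R x"
      by (subst (asm) ennreal_le_iff) (auto simp: R_def)
    moreover have "(2 ^ n * cmod (d n x))\<^sup>2 = 4 ^ n * (cmod (d n x))\<^sup>2"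
      using power_mult_distrib[of "2::real" 2 n] by (simp add: power_mult_distrib power2_eq_square)
    ultimately have "(2 ^ n * cmod (d n x))\<^sup>2 \<le> R x"
      by simp
    then have "2 ^ n * cmod (d n x) \<le> sqrt (R x)"
      by (rule real_le_rsqrt)
    then show ?thesis by (simp add: field_simps power_divide)
  qed
  have partial: "g n x = g 0 x + (\<Sum>j<n. d j x)" for n x
    unfolding d_def by (simp add: sum_lessThan_telescope[of "\<lambda>n. g n x"])
  have summ: "summable (\<lambda>n. sqrt (R x) * (1/2) ^ n)" for x
    by (intro summable_mult summable_geometric) simp
  have g_le: "cmod (g n x) \<le> cmod (g 0 x) + 2 * sqrt (R x)" if "S x \<noteq> \<infinity>" for n x
  proof -
    have "cmod (g n x) \<le> cmod (g 0 x) + (\<Sum>j<n. cmod (d j x))"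
      unfolding partial[of n] by (rule order_trans[OF norm_triangle_ineq add_left_mono[OF norm_sum]])
    also have "(\<Sum>j<n. cmod (d j x)) \<le> (\<Sum>j<n. sqrt (R x) * (1/2) ^ j)"
      by (intro sum_mono d_le that)
    also have "\<dots> \<le> (\<Sum>j. sqrt (R x) * (1/2) ^ j)"
      by (intro sum_le_suminf summ) (auto simp: R_def)
    also have "\<dots> = 2 * sqrt (R x)"
      by (simp add: suminf_mult summable_geometric suminf_geometric)
    finally show ?thesis by simp
  qed
  have g_conv: "convergent (\<lambda>n. g n x)" if "S x \<noteq> \<infinity>" for x
  proof -
    have "summable (\<lambda>n. d n x)"
      by (rule summable_comparison_test'[OF summ[of x], of 0]) (use d_le[OF that] in auto)
    then have "(\<lambda>n. g 0 x + (\<Sum>j<n. d j x)) \<longlonglongrightarrow> g 0 x + (\<Sum>j. d j x)"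
      by (intro tendsto_intros summable_LIMSEQ)
    then show ?thesis
      unfolding convergent_def partial[symmetric] by blast
  qed
  define h where "h x = lim (\<lambda>n. g n x)" for x
  have hm [measurable]: "h \<in> borel_measurable M"
    unfolding h_def by measurable
  have g_lim: "(\<lambda>n. g n x) \<longlonglongrightarrow> h x" if "S x \<noteq> \<infinity>" for x
    unfolding h_def using g_conv[OF that] by (simp add: convergent_LIMSEQ_iff)
  define D where "D x = complex_of_real (cmod (g 0 x) + 2 * sqrt (R x))" for x
  have R0: "0 \<le> R x" for x by (simp add: R_def)
  have D: "square_integrable M D"
  proof -
    have "square_integrable M (\<lambda>x. 2 * complex_of_real (sqrt (R x)))"
      unfolding square_integrable_def
      using R_int by (auto simp: power_mult_distrib norm_mult R0)
    moreover have "square_integrable M (\<lambda>x. - complex_of_real (cmod (g 0 x)))"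
      using g[of 0] by (auto simp: square_integrable_def)
    ultimately show ?thesis
      using square_integrable_diff[of M "\<lambda>x. 2 * complex_of_real (sqrt (R x))"
          "\<lambda>x. - complex_of_real (cmod (g 0 x))"]
      by (simp add: D_def[abs_def] add.commute)
  qed
  have D_norm: "cmod (D x) = cmod (g 0 x) + 2 * sqrt (R x)" for x
    unfolding D_def using R0[of x] by (simp only: norm_of_real) simp
  have h_le: "cmod (h x) \<le> cmod (D x)" if "S x \<noteq> \<infinity>" for x
    unfolding D_norm by (rule LIMSEQ_le_const2[OF tendsto_norm[OF g_lim[OF that]]]) (use g_le[OF that] in auto)
  have h: "square_integrable M h"
    unfolding square_integrable_def
    by (intro conjI hm Bochner_Integration.integrable_bound[OF square_integrableD(2)[OF D]])
      (use S_fin h_le in \<open>auto elim!: eventually_mono intro!: power_mono\<close>)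
  moreover have "(\<lambda>n. \<integral>x. f x * cnj (g n x) \<partial>M) \<longlonglongrightarrow> (\<integral>x. f x * cnj (h x) \<partial>M)"
    if f: "square_integrable M f" for f
  proof (rule integral_dominated_convergence)
    note [measurable] = square_integrableD(1)[OF f]
    show "(\<lambda>x. f x * cnj (h x)) \<in> borel_measurable M" by measurable
    show "(\<lambda>x. f x * cnj (g n x)) \<in> borel_measurable M" for n by measurable
    show "integrable M (\<lambda>x. cmod (f x * D x))"
      using integrable_mult_square_integrable[OF f D] by simp
    show "AE x in M. (\<lambda>n. f x * cnj (g n x)) \<longlonglongrightarrow> f x * cnj (h x)"
      using S_fin by eventually_elim (intro tendsto_intros g_lim)
    show "AE x in M. norm (f x * cnj (g n x)) \<le> cmod (f x * D x)" for n
      using S_fin by eventually_elim (simp add: norm_mult D_norm g_le mult_left_mono)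
  qed
  ultimately show ?thesis by blast
qed

section \<open>Integral operators whose Gram kernel passes the Schur test\<close>

text \<open>
  If \<open>T\<close> is the integral operator with kernel \<open>k\<close>, the inner products of the rows of \<open>k\<close> form the
  kernel of \<open>T T\<^sup>*\<close>. This Gram kernel is Hermitian, so a bound on its row integrals is all that
  Schur's test asks for, and a bound on \<open>T T\<^sup>*\<close> is a bound on \<open>T\<close>. The bound \<open>B\<close> on the rows
  themselves makes \<open>T f\<close> bounded and the integrals in the proofs absolutely convergent.
\<close>

locale schur_kernel = pair_sigma_finite M N for M :: "'a measure" and N :: "'b measure" +
  fixes k :: "'a \<Rightarrow> 'b \<Rightarrow> complex" and A B :: real
  assumes measurable_kernel [measurable]: "case_prod k \<in> borel_measurable (M \<Otimes>\<^sub>M N)"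
    and row: "\<And>z. z \<in> space M \<Longrightarrow> square_integrable N (k z)"
    and row_energy: "\<And>z. z \<in> space M \<Longrightarrow> energy N (k z) \<le> B"
    and gram_bound: "\<And>z. z \<in> space M \<Longrightarrow>
      (\<integral>\<^sup>+\<zeta>. ennreal (cmod (\<integral>x. k z x * cnj (k \<zeta> x) \<partial>N)) \<partial>M) \<le> ennreal A"
    and A_nonneg: "0 \<le> A" and B_nonneg: "0 \<le> B"
begin

definition ker_op :: "('b \<Rightarrow> complex) \<Rightarrow> 'a \<Rightarrow> complex" where
  "ker_op f z = (\<integral>x. k z x * f x \<partial>N)"

definition ker_adj :: "('a \<Rightarrow> complex) \<Rightarrow> 'b \<Rightarrow> complex" where
  "ker_adj F x = (\<integral>z. cnj (k z x) * F z \<partial>M)"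

definition gram :: "'a \<Rightarrow> 'a \<Rightarrow> complex" where
  "gram z \<zeta> = (\<integral>x. k z x * cnj (k \<zeta> x) \<partial>N)"

lemma measurable_ker_op:
  assumes [measurable]: "f \<in> borel_measurable N"
  shows "ker_op f \<in> borel_measurable M"
  unfolding ker_op_def by measurable

lemma measurable_ker_adj:
  assumes [measurable]: "F \<in> borel_measurable M"
  shows "ker_adj F \<in> borel_measurable N"
  unfolding ker_adj_def by measurable

lemma measurable_gram [measurable]: "case_prod gram \<in> borel_measurable (M \<Otimes>\<^sub>M M)"
  unfolding gram_def by measurable

lemma gram_commute: "gram \<zeta> z = cnj (gram z \<zeta>)"
  unfolding gram_def by (subst Bochner_Integration.integral_cnj[symmetric]) (simp add: mult.commute del: Bochner_Integration.integral_cnj)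

lemma ker_op_pointwise:
  assumes f: "square_integrable N f" and z: "z \<in> space M"
  shows "(\<integral>x. cmod (k z x * f x) \<partial>N) \<le> sqrt (B * energy N f)"
  by (rule real_le_rsqrt[OF order_trans[OF Cauchy_Schwarz_abs_integral[OF row[OF z] f]]])
    (intro mult_right_mono row_energy z energy_nonneg)

lemma cmod_ker_op_le:
  assumes "square_integrable N f" "z \<in> space M"
  shows "cmod (ker_op f z) \<le> sqrt (B * energy N f)"
  unfolding ker_op_def
  by (rule order_trans[OF integral_norm_bound ker_op_pointwise[OF assms]])

text \<open>
  Integrability of \<open>F\<close> makes the double integral absolutely convergent, because \<open>ker_op\<close> of the
  moduli is uniformly bounded. Fubini's theorem then moves the operator to the other side.
\<close>

lemma
  assumes f: "square_integrable N f" and F: "integrable M F"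
  shows integrable_pairing: "integrable M (\<lambda>z. ker_op f z * cnj (F z))"
    and pairing: "(\<integral>z. ker_op f z * cnj (F z) \<partial>M) = (\<integral>x. f x * cnj (ker_adj F x) \<partial>N)"
proof -
  note [measurable] = square_integrableD(1)[OF f] borel_measurable_integrable[OF F]
  have int: "integrable (M \<Otimes>\<^sub>M N) (\<lambda>(z, x). k z x * f x * cnj (F z))"
  proof (rule Fubini_integrable)
    show "(\<lambda>(z, x). k z x * f x * cnj (F z)) \<in> borel_measurable (M \<Otimes>\<^sub>M N)"
      by measurable
    have "cmod (F z) * (\<integral>x. cmod (k z x * f x) \<partial>N) \<le> cmod (F z) * sqrt (B * energy N f)"
      if "z \<in> space M" for z
      by (intro mult_left_mono ker_op_pointwise f that) simp
    moreover have "0 \<le> cmod (F z) * (\<integral>x. cmod (k z x * f x) \<partial>N)" for z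
      by (intro mult_nonneg_nonneg integral_nonneg_AE) auto
    ultimately have "integrable M (\<lambda>z. cmod (F z) * (\<integral>x. cmod (k z x * f x) \<partial>N))"
      by (intro Bochner_Integration.integrable_bound[OF integrable_mult_left[OF integrable_norm[OF F],
              of "sqrt (B * energy N f)"]])
        (auto intro!: AE_I2 intro: order_trans[OF _ abs_ge_self])
    then show "integrable M (\<lambda>z. \<integral>x. norm (case (z, x) of (z, x) \<Rightarrow> k z x * f x * cnj (F z)) \<partial>N)"
      by (simp add: norm_mult mult.commute[of "cmod (F _)"])
    show "AE z in M. integrable N (\<lambda>x. case (z, x) of (z, x) \<Rightarrow> k z x * f x * cnj (F z))"
      by (intro AE_I2) (simp add: integrable_mult_left integrable_mult_square_integrable row f)
  qed
  have inner: "(\<integral>z. k z x * f x * cnj (F z) \<partial>M) = f x * cnj (ker_adj F x)" for x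
  proof -
    have "cnj (ker_adj F x) = (\<integral>z. k z x * cnj (F z) \<partial>M)"
      unfolding ker_adj_def by (subst Bochner_Integration.integral_cnj[symmetric]) (simp del: Bochner_Integration.integral_cnj)
    then show ?thesis by (simp add: mult_ac flip: integral_mult_right_zero)
  qed
  show "integrable M (\<lambda>z. ker_op f z * cnj (F z))"
    using integrable_fst'[OF int] by (simp add: ker_op_def)
  show "(\<integral>z. ker_op f z * cnj (F z) \<partial>M) = (\<integral>x. f x * cnj (ker_adj F x) \<partial>N)"
    using Fubini_integral[OF int] by (simp add: ker_op_def inner)
qed

text \<open>
  Splitting \<open>\<bar>k z x\<bar> \<bar>F z\<bar>\<close> as \<open>(\<bar>k z x\<bar> \<surd>\<bar>F z\<bar>) \<surd>\<bar>F z\<bar>\<close> before applying the Cauchy-Schwarz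
  inequality leaves an integral over both variables that is controlled by the energy of the rows.
  The resulting bound involves the \<open>L\<^sup>1\<close> norm of \<open>F\<close> and only serves to justify the pairing of
  \<open>ker_adj F\<close> with itself; the \<open>L\<^sup>2\<close> bound is \<open>energy_ker_adj_le\<close>.
\<close>

lemma square_integrable_ker_adj:
  assumes F: "integrable M F"
  shows "square_integrable N (ker_adj F)"
proof (rule square_integrable_bounded_energy)
  note [measurable] = borel_measurable_integrable[OF F]
  define I where "I = (\<integral>z. cmod (F z) \<partial>M)"
  have I: "(\<integral>\<^sup>+z. ennreal (cmod (F z)) \<partial>M) = ennreal I" and "0 \<le> I"
    unfolding I_def using F by (auto intro!: nn_integral_eq_integral)
  show "ker_adj F \<in> borel_measurable N"
    by (rule measurable_ker_adj) measurable
  have pw: "ennreal ((cmod (ker_adj F x))\<^sup>2) \<le>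
      (\<integral>\<^sup>+z. ennreal ((cmod (k z x))\<^sup>2 * cmod (F z)) \<partial>M) * ennreal I" if x [measurable]: "x \<in> space N" for x
  proof -
    \<comment> \<open>The integrand is written as a product with factors \<open>\<surd>\<bar>F z\<bar>\<close>, to be separated by Cauchy-Schwarz.\<close>
    have "ennreal (cmod (ker_adj F x)) \<le> (\<integral>\<^sup>+z. ennreal (cmod (k z x) * sqrt (cmod (F z))) * ennreal (sqrt (cmod (F z))) \<partial>M)"
      unfolding ker_adj_def
      by (rule order_trans[OF norm_integral_le_nn_integral]) (simp add: norm_mult mult.assoc flip: ennreal_mult)
    then have "(ennreal (cmod (ker_adj F x)))\<^sup>2 \<le> (\<integral>\<^sup>+z. ennreal (cmod (k z x) * sqrt (cmod (F z))) * ennreal (sqrt (cmod (F z))) \<partial>M)\<^sup>2"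
      by (intro power_mono) auto
    also have "\<dots> \<le> (\<integral>\<^sup>+z. (ennreal (cmod (k z x) * sqrt (cmod (F z))))\<^sup>2 \<partial>M) *
        (\<integral>\<^sup>+z. (ennreal (sqrt (cmod (F z))))\<^sup>2 \<partial>M)"
      by (rule Cauchy_Schwarz_nn_integral; measurable)
    also have "\<dots> = (\<integral>\<^sup>+z. ennreal ((cmod (k z x))\<^sup>2 * cmod (F z)) \<partial>M) * ennreal I"
      by (simp add: ennreal_power power_mult_distrib I)
    finally show ?thesis by (simp add: ennreal_power)
  qed
  have "(\<integral>\<^sup>+x. ennreal ((cmod (ker_adj F x))\<^sup>2) \<partial>N) \<le>
      (\<integral>\<^sup>+x. (\<integral>\<^sup>+z. ennreal ((cmod (k z x))\<^sup>2 * cmod (F z)) \<partial>M) * ennreal I \<partial>N)"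
    by (intro nn_integral_mono pw)
  also have "\<dots> = (\<integral>\<^sup>+x. (\<integral>\<^sup>+z. ennreal ((cmod (k z x))\<^sup>2 * cmod (F z)) \<partial>M) \<partial>N) * ennreal I"
    by (rule nn_integral_multc) measurable
  also have "(\<integral>\<^sup>+x. (\<integral>\<^sup>+z. ennreal ((cmod (k z x))\<^sup>2 * cmod (F z)) \<partial>M) \<partial>N) =
      (\<integral>\<^sup>+z. (\<integral>\<^sup>+x. ennreal ((cmod (k z x))\<^sup>2 * cmod (F z)) \<partial>N) \<partial>M)"
    by (rule Fubini') measurable
  also have "\<dots> \<le> (\<integral>\<^sup>+z. ennreal B * ennreal (cmod (F z)) \<partial>M)"
  proof (intro nn_integral_mono)
    fix z assume z: "z \<in> space M"
    note [measurable] = square_integrableD(1)[OF row[OF z]]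
    have "(\<integral>\<^sup>+x. ennreal ((cmod (k z x))\<^sup>2 * cmod (F z)) \<partial>N) = ennreal (energy N (k z)) * ennreal (cmod (F z))"
      by (simp add: ennreal_mult nn_integral_multc nn_integral_energy row z)
    also have "\<dots> \<le> ennreal B * ennreal (cmod (F z))"
      by (intro mult_right_mono ennreal_leI row_energy z) simp
    finally show "(\<integral>\<^sup>+x. ennreal ((cmod (k z x))\<^sup>2 * cmod (F z)) \<partial>N) \<le> ennreal B * ennreal (cmod (F z))" .
  qed
  also have "\<dots> = ennreal B * ennreal I"
    by (simp add: nn_integral_cmult I)
  finally show "(\<integral>\<^sup>+x. ennreal ((cmod (ker_adj F x))\<^sup>2) \<partial>N) \<le> ennreal (B * I * I)"
    using \<open>0 \<le> I\<close> B_nonneg by (simp add: ennreal_mult mult_right_mono)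
  show "0 \<le> B * I * I" using \<open>0 \<le> I\<close> B_nonneg by simp
qed

lemma ker_op_cnj_row: "ker_op (\<lambda>x. cnj (k z x)) \<zeta> = cnj (gram z \<zeta>)"
  unfolding ker_op_def gram_commute[symmetric] by (simp add: gram_def)

text \<open>
  The evaluation of \<open>ker_op g\<close> at \<open>z\<close> is the pairing of \<open>g\<close> with a conjugated row of the kernel,
  so any weak adjoint \<open>g\<close> of \<open>F\<close> can be tested against this row. The statement does not fix
  how \<open>g\<close> arises, so that it applies both to \<open>ker_adj F\<close> and to limits of such functions.
\<close>

lemma ker_op_eq_gram_integral:
  assumes adj: "\<And>f. square_integrable N f \<Longrightarrow>
      (\<integral>z. ker_op f z * cnj (F z) \<partial>M) = (\<integral>x. f x * cnj (g x) \<partial>N)"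
    and z: "z \<in> space M"
  shows "ker_op g z = (\<integral>\<zeta>. gram z \<zeta> * F \<zeta> \<partial>M)"
proof -
  have "(\<integral>\<zeta>. cnj (gram z \<zeta> * F \<zeta>) \<partial>M) = (\<integral>x. cnj (k z x * g x) \<partial>N)"
    using adj[OF square_integrable_cnj[OF row[OF z]]] by (simp add: ker_op_cnj_row)
  then show ?thesis
    unfolding Bochner_Integration.integral_cnj ker_op_def by (metis complex_cnj_cnj)
qed

lemma ker_op_ker_adj:
  assumes F: "integrable M F" and z: "z \<in> space M"
  shows "ker_op (ker_adj F) z = (\<integral>\<zeta>. gram z \<zeta> * F \<zeta> \<partial>M)"
  by (rule ker_op_eq_gram_integral[OF pairing[OF _ F] z])

text \<open>
  By \<open>2 \<bar>F \<zeta>\<bar> \<bar>F z\<bar> \<le> \<bar>F z\<bar>\<^sup>2 + \<bar>F \<zeta>\<bar>\<^sup>2\<close> the integral splits into two parts, which agree because the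
  Gram kernel is Hermitian.
\<close>

lemma Schur_test:
  assumes F: "square_integrable M F"
  shows "(\<integral>\<^sup>+z. \<integral>\<^sup>+\<zeta>. ennreal (cmod (gram z \<zeta>) * cmod (F \<zeta>) * cmod (F z)) \<partial>M \<partial>M) \<le> ennreal (A * energy M F)"
proof -
  interpret MM: pair_sigma_finite M M ..
  note [measurable] = square_integrableD(1)[OF F]
  let ?h = "\<lambda>z \<zeta>. ennreal (cmod (gram z \<zeta>)) * ennreal ((cmod (F z))\<^sup>2 / 2)"
  have half: "(\<integral>\<^sup>+z. \<integral>\<^sup>+\<zeta>. ?h z \<zeta> \<partial>M \<partial>M) \<le> ennreal (A * energy M F / 2)"
  proof -
    have "(\<integral>\<^sup>+z. \<integral>\<^sup>+\<zeta>. ?h z \<zeta> \<partial>M \<partial>M) \<le> (\<integral>\<^sup>+z. ennreal A * ennreal ((cmod (F z))\<^sup>2 / 2) \<partial>M)"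
    proof (intro nn_integral_mono)
      fix z assume z [measurable]: "z \<in> space M"
      have "(\<integral>\<^sup>+\<zeta>. ?h z \<zeta> \<partial>M) = (\<integral>\<^sup>+\<zeta>. ennreal (cmod (gram z \<zeta>)) \<partial>M) * ennreal ((cmod (F z))\<^sup>2 / 2)"
        by (rule nn_integral_multc) measurable
      also have "\<dots> \<le> ennreal A * ennreal ((cmod (F z))\<^sup>2 / 2)"
        unfolding gram_def by (intro mult_right_mono gram_bound z) simp
      finally show "(\<integral>\<^sup>+\<zeta>. ?h z \<zeta> \<partial>M) \<le> ennreal A * ennreal ((cmod (F z))\<^sup>2 / 2)" .
    qed
    also have "\<dots> = (\<integral>\<^sup>+z. ennreal (A / 2) * ennreal ((cmod (F z))\<^sup>2) \<partial>M)"
      using A_nonneg by (simp flip: ennreal_mult')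
    also have "\<dots> = ennreal (A / 2) * ennreal (energy M F)"
      by (simp add: nn_integral_cmult nn_integral_energy F)
    also have "\<dots> = ennreal (A * energy M F / 2)"
      using A_nonneg by (simp flip: ennreal_mult')
    finally show ?thesis .
  qed
  have "(\<integral>\<^sup>+z. \<integral>\<^sup>+\<zeta>. ennreal (cmod (gram z \<zeta>) * cmod (F \<zeta>) * cmod (F z)) \<partial>M \<partial>M) \<le>
      (\<integral>\<^sup>+z. \<integral>\<^sup>+\<zeta>. ?h z \<zeta> + ?h \<zeta> z \<partial>M \<partial>M)"
  proof (intro nn_integral_mono)
    fix z \<zeta>
    have "cmod (gram \<zeta> z) = cmod (gram z \<zeta>)"
      by (subst gram_commute) simp
    moreover have "cmod (F \<zeta>) * cmod (F z) \<le> (cmod (F z))\<^sup>2 / 2 + (cmod (F \<zeta>))\<^sup>2 / 2"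
      using sum_squares_bound[of "cmod (F \<zeta>)" "cmod (F z)"] by simp
    then have "cmod (gram z \<zeta>) * (cmod (F \<zeta>) * cmod (F z)) \<le>
        cmod (gram z \<zeta>) * ((cmod (F z))\<^sup>2 / 2 + (cmod (F \<zeta>))\<^sup>2 / 2)"
      by (intro mult_left_mono) auto
    ultimately show "ennreal (cmod (gram z \<zeta>) * cmod (F \<zeta>) * cmod (F z)) \<le> ?h z \<zeta> + ?h \<zeta> z"
      by (simp add: distrib_left mult.assoc ennreal_leI flip: ennreal_mult' ennreal_plus)
  qed
  also have "\<dots> = (\<integral>\<^sup>+z. (\<integral>\<^sup>+\<zeta>. ?h z \<zeta> \<partial>M) + (\<integral>\<^sup>+\<zeta>. ?h \<zeta> z \<partial>M) \<partial>M)"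
    by (intro nn_integral_cong nn_integral_add) measurable
  also have "\<dots> = (\<integral>\<^sup>+z. \<integral>\<^sup>+\<zeta>. ?h z \<zeta> \<partial>M \<partial>M) + (\<integral>\<^sup>+z. \<integral>\<^sup>+\<zeta>. ?h \<zeta> z \<partial>M \<partial>M)"
    by (rule nn_integral_add) measurable
  also have "(\<integral>\<^sup>+z. \<integral>\<^sup>+\<zeta>. ?h \<zeta> z \<partial>M \<partial>M) = (\<integral>\<^sup>+z. \<integral>\<^sup>+\<zeta>. ?h z \<zeta> \<partial>M \<partial>M)"
    by (rule MM.Fubini') measurable
  also have "(\<integral>\<^sup>+z. \<integral>\<^sup>+\<zeta>. ?h z \<zeta> \<partial>M \<partial>M) + (\<integral>\<^sup>+z. \<integral>\<^sup>+\<zeta>. ?h z \<zeta> \<partial>M \<partial>M) \<le>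
      ennreal (A * energy M F / 2) + ennreal (A * energy M F / 2)"
    by (intro add_mono half)
  also have "\<dots> = ennreal (A * energy M F)"
    using A_nonneg by (simp flip: ennreal_plus)
  finally show ?thesis .
qed

text \<open>
  The energy of \<open>ker_adj F\<close> is the pairing of \<open>ker_op (ker_adj F)\<close> with \<open>F\<close>, that is, the quadratic
  form of the Gram kernel at \<open>F\<close>.
\<close>

lemma energy_ker_adj_le:
  assumes F: "integrable M F" and F2: "square_integrable M F"
  shows "energy N (ker_adj F) \<le> A * energy M F"
proof -
  note [measurable] = square_integrableD(1)[OF F2]
  have "ennreal (energy N (ker_adj F)) = ennreal (cmod (\<integral>z. ker_op (ker_adj F) z * cnj (F z) \<partial>M))"
    by (simp add: pairing[OF square_integrable_ker_adj[OF F] F] integral_mult_cnj_self)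
  also have "\<dots> \<le> (\<integral>\<^sup>+z. ennreal (cmod (ker_op (ker_adj F) z * cnj (F z))) \<partial>M)"
    by (rule norm_integral_le_nn_integral)
  also have "\<dots> \<le> (\<integral>\<^sup>+z. \<integral>\<^sup>+\<zeta>. ennreal (cmod (gram z \<zeta>) * cmod (F \<zeta>) * cmod (F z)) \<partial>M \<partial>M)"
  proof (intro nn_integral_mono)
    fix z assume z [measurable]: "z \<in> space M"
    have "ennreal (cmod (ker_op (ker_adj F) z * cnj (F z))) =
        ennreal (cmod (\<integral>\<zeta>. gram z \<zeta> * F \<zeta> \<partial>M)) * ennreal (cmod (F z))"
      by (simp add: ker_op_ker_adj[OF F z] norm_mult ennreal_mult)
    also have "\<dots> \<le> (\<integral>\<^sup>+\<zeta>. ennreal (cmod (gram z \<zeta> * F \<zeta>)) \<partial>M) * ennreal (cmod (F z))"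
      by (intro mult_right_mono norm_integral_le_nn_integral) simp
    also have "\<dots> = (\<integral>\<^sup>+\<zeta>. ennreal (cmod (gram z \<zeta> * F \<zeta>)) * ennreal (cmod (F z)) \<partial>M)"
      by (rule nn_integral_multc[symmetric]) measurable
    finally show "ennreal (cmod (ker_op (ker_adj F) z * cnj (F z))) \<le>
        (\<integral>\<^sup>+\<zeta>. ennreal (cmod (gram z \<zeta>) * cmod (F \<zeta>) * cmod (F z)) \<partial>M)"
      by (simp add: norm_mult ennreal_mult)
  qed
  also have "\<dots> \<le> ennreal (A * energy M F)"
    by (rule Schur_test[OF F2])
  finally show ?thesis
    using A_nonneg by (simp add: ennreal_le_iff)
qed

text \<open>
  The integral defining \<open>ker_adj\<close> may diverge at exceptional points and is then \<open>0\<close>, so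
  \<open>ker_adj\<close> is not additive pointwise. The comparison with \<open>ker_adj (F - G)\<close> is made through
  pairings instead, where additivity is available.
\<close>

lemma energy_ker_adj_diff_le:
  assumes F: "integrable M F" "square_integrable M F" and G: "integrable M G" "square_integrable M G"
  shows "energy N (\<lambda>x. ker_adj F x - ker_adj G x) \<le> A * energy M (\<lambda>z. F z - G z)"
proof -
  define u where "u x = ker_adj F x - ker_adj G x" for x
  have FG: "integrable M (\<lambda>z. F z - G z)" "square_integrable M (\<lambda>z. F z - G z)"
    by (intro Bochner_Integration.integrable_diff square_integrable_diff F G)+
  note adj = square_integrable_ker_adj[OF F(1)] square_integrable_ker_adj[OF G(1)]
  have u: "square_integrable N u"
    unfolding u_def by (intro square_integrable_diff adj)
  have "(\<integral>x. u x * cnj (u x) \<partial>N) = (\<integral>x. u x * cnj (ker_adj F x) \<partial>N) - (\<integral>x. u x * cnj (ker_adj G x) \<partial>N)"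
    using Bochner_Integration.integral_diff[OF
        integrable_mult_square_integrable[OF u square_integrable_cnj[OF adj(1)]]
        integrable_mult_square_integrable[OF u square_integrable_cnj[OF adj(2)]]]
    by (simp add: u_def right_diff_distrib)
  also have "\<dots> = (\<integral>z. ker_op u z * cnj (F z - G z) \<partial>M)"
    using integrable_pairing[OF u F(1)] integrable_pairing[OF u G(1)]
    by (simp add: pairing[OF u F(1), symmetric] pairing[OF u G(1), symmetric] right_diff_distrib)
  also have "\<dots> = (\<integral>x. u x * cnj (ker_adj (\<lambda>z. F z - G z) x) \<partial>N)"
    by (rule pairing[OF u FG(1)])
  finally have "energy N u \<le> energy N (ker_adj (\<lambda>z. F z - G z))"
    by (rule energy_le_of_self_pairing[OF u square_integrable_ker_adj[OF FG(1)]])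
  also have "\<dots> \<le> A * energy M (\<lambda>z. F z - G z)"
    by (rule energy_ker_adj_le[OF FG])
  finally show ?thesis unfolding u_def .
qed

text \<open>
  Duality: truncating \<open>ker_op f\<close> to sets of finite measure gives functions \<open>F n\<close> in \<open>L\<^sup>1 \<inter> L\<^sup>2\<close> whose
  energy is the pairing of \<open>f\<close> with \<open>ker_adj (F n)\<close>. The bound on \<open>ker_adj\<close> then bounds the energy of
  \<open>F n\<close> uniformly in \<open>n\<close>.
\<close>

lemma square_integrable_ker_op:
  assumes f: "square_integrable N f"
  shows "square_integrable M (ker_op f)"
proof (rule square_integrable_bounded_energy)
  have [measurable]: "ker_op f \<in> borel_measurable M"
    by (rule measurable_ker_op) (use f in auto)
  show "ker_op f \<in> borel_measurable M" by fact
  show "0 \<le> A * energy N f" using A_nonneg by simp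
  obtain D :: "nat \<Rightarrow> 'a set" where D: "range D \<subseteq> sets M" "(\<Union>i. D i) = space M"
      "\<And>i. emeasure M (D i) \<noteq> \<infinity>" "incseq D"
    using M1.sigma_finite_incseq by metis
  have [measurable]: "D n \<in> sets M" for n using D by auto
  define F where "F n z = ker_op f z * indicator (D n) z" for n z
  have Fm [measurable]: "F n \<in> borel_measurable M" for n
    unfolding F_def by measurable
  have ind_int: "integrable M (\<lambda>z. indicator (D n) z :: real)" for n
    using D(3)[of n] by (intro integrable_real_indicator) (auto simp: top.not_eq_extremum)
  have F_le: "cmod (F n z) \<le> sqrt (B * energy N f) * indicator (D n) z" if "z \<in> space M" for n z
    unfolding F_def using cmod_ker_op_le[OF f that] by (auto simp: indicator_def)
  have Fint: "integrable M (F n)" for n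
    by (rule Bochner_Integration.integrable_bound[OF integrable_mult_right[OF ind_int, of "sqrt (B * energy N f)" n]])
      (use F_le B_nonneg in \<open>auto intro!: AE_I2\<close>)
  have F2: "square_integrable M (F n)" for n
    unfolding square_integrable_def
  proof
    have "(cmod (F n z))\<^sup>2 \<le> (sqrt (B * energy N f))\<^sup>2 * indicator (D n) z" if "z \<in> space M" for z
      using power_mono[OF F_le[OF that, of n], of 2] by (auto simp: power_mult_distrib indicator_def)
    then show "integrable M (\<lambda>z. (cmod (F n z))\<^sup>2)"
      by (intro Bochner_Integration.integrable_bound[OF integrable_mult_right[OF ind_int, of "(sqrt (B * energy N f))\<^sup>2" n]])
        (use B_nonneg in \<open>auto intro!: AE_I2\<close>)
  qed measurable
  have F_bound: "energy M (F n) \<le> A * energy N f" for n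
  proof -
    have "(\<integral>z. ker_op f z * cnj (F n z) \<partial>M) = complex_of_real (energy M (F n))"
      unfolding integral_mult_cnj_self[symmetric]
      by (intro Bochner_Integration.integral_cong) (auto simp: F_def indicator_def)
    then have eq: "complex_of_real (energy M (F n)) = (\<integral>x. f x * cnj (ker_adj (F n) x) \<partial>N)"
      by (simp add: pairing[OF f Fint])
    have "(energy M (F n))\<^sup>2 \<le> energy N f * energy N (ker_adj (F n))"
      using Cauchy_Schwarz_integral[OF f square_integrable_cnj[OF square_integrable_ker_adj[OF Fint]], of n]
      unfolding eq[symmetric] by simp
    also have "\<dots> \<le> energy N f * (A * energy M (F n))"
      by (intro mult_left_mono energy_ker_adj_le Fint F2) simp
    finally have "energy M (F n) * energy M (F n) \<le> (A * energy N f) * energy M (F n)"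
      by (simp add: power2_eq_square mult_ac)
    then show ?thesis
      using A_nonneg by (cases "energy M (F n) = 0") (auto simp: mult_le_cancel_right less_le)
  qed
  have "(\<integral>\<^sup>+z. ennreal ((cmod (ker_op f z))\<^sup>2) \<partial>M) = (\<integral>\<^sup>+z. (SUP n. ennreal ((cmod (F n z))\<^sup>2)) \<partial>M)"
  proof (rule nn_integral_cong)
    fix z assume "z \<in> space M"
    then obtain n where "z \<in> D n" using D(2) by blast
    then have "ennreal ((cmod (ker_op f z))\<^sup>2) = ennreal ((cmod (F n z))\<^sup>2)"
      by (simp add: F_def)
    also have "\<dots> \<le> (SUP n. ennreal ((cmod (F n z))\<^sup>2))" by (rule SUP_upper) simp
    finally have "ennreal ((cmod (ker_op f z))\<^sup>2) \<le> (SUP n. ennreal ((cmod (F n z))\<^sup>2))" .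
    moreover have "(SUP n. ennreal ((cmod (F n z))\<^sup>2)) \<le> ennreal ((cmod (ker_op f z))\<^sup>2)"
      by (rule SUP_least) (auto simp: F_def indicator_def)
    ultimately show "ennreal ((cmod (ker_op f z))\<^sup>2) = (SUP n. ennreal ((cmod (F n z))\<^sup>2))"
      by (rule antisym)
  qed
  also have "\<dots> = (SUP n. \<integral>\<^sup>+z. ennreal ((cmod (F n z))\<^sup>2) \<partial>M)"
  proof (rule nn_integral_monotone_convergence_SUP)
    show "incseq (\<lambda>n z. ennreal ((cmod (F n z))\<^sup>2))"
      using \<open>incseq D\<close> by (fastforce simp: incseq_def le_fun_def F_def indicator_def)
  qed measurable
  also have "\<dots> \<le> ennreal (A * energy N f)"
    using F_bound by (intro SUP_least) (simp add: nn_integral_energy F2 ennreal_leI)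
  finally show "(\<integral>\<^sup>+z. ennreal ((cmod (ker_op f z))\<^sup>2) \<partial>M) \<le> ennreal (A * energy N f)" .
qed

lemma integrable_gram_mult:
  assumes "square_integrable M F" and z: "z \<in> space M"
  shows "integrable M (\<lambda>\<zeta>. gram z \<zeta> * F \<zeta>)"
  using square_integrable_cnj[OF square_integrable_ker_op[OF square_integrable_cnj[OF row[OF z]]]]
  by (intro integrable_mult_square_integrable assms) (simp add: ker_op_cnj_row)

text \<open>
  Cutting \<open>F\<close> off where it is small makes it integrable, since \<open>\<bar>F\<bar> \<le> n \<bar>F\<bar>\<^sup>2\<close> where \<open>\<bar>F\<bar> \<ge> 1 / n\<close>. The
  adjoint at \<open>F\<close> is the limit of \<open>ker_adj\<close> along cut-offs that approach \<open>F\<close> fast enough.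
\<close>

lemma adjoint_exists:
  assumes F: "square_integrable M F"
  shows "\<exists>g. square_integrable N g \<and> (\<forall>f. square_integrable N f \<longrightarrow>
    (\<integral>z. ker_op f z * cnj (F z) \<partial>M) = (\<integral>x. f x * cnj (g x) \<partial>N))"
proof -
  note [measurable] = square_integrableD(1)[OF F]
  define cut where "cut n z = (if 1 / Suc n \<le> cmod (F z) then F z else 0)" for n z
  have cm [measurable]: "cut n \<in> borel_measurable M" for n
    unfolding cut_def by measurable
  have cut_le: "cmod (cut n z) \<le> cmod (F z)" for n z
    by (simp add: cut_def)
  have cut2: "square_integrable M (cut n)" for n
    by (rule square_integrable_dominated[OF cm F cut_le])
  have cut1: "integrable M (cut n)" for n
  proof (rule Bochner_Integration.integrable_bound)
    show "integrable M (\<lambda>z. Suc n * (cmod (F z))\<^sup>2)"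
      using F by (intro integrable_mult_right) auto
    have "cmod (cut n z) \<le> Suc n * (cmod (F z))\<^sup>2" for z
    proof (cases "1 / Suc n \<le> cmod (F z)")
      case True
      then have "1 * cmod (F z) \<le> (Suc n * cmod (F z)) * cmod (F z)"
        by (intro mult_right_mono) (auto simp: field_simps)
      then show ?thesis using True by (simp add: cut_def power2_eq_square mult.assoc)
    qed (simp add: cut_def)
    then show "AE z in M. norm (cut n z) \<le> norm (Suc n * (cmod (F z))\<^sup>2)"
      by (simp add: abs_mult)
  qed measurable
  have cut_lim: "(\<lambda>n. energy M (\<lambda>z. F z - cut n z)) \<longlonglongrightarrow> 0"
  proof -
    have "(\<lambda>n. \<integral>z. (cmod (F z - cut n z))\<^sup>2 \<partial>M) \<longlonglongrightarrow> (\<integral>z. 0 \<partial>M)"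
    proof (rule integral_dominated_convergence)
      show "integrable M (\<lambda>z. (cmod (F z))\<^sup>2)" using F by auto
      show "AE z in M. (\<lambda>n. (cmod (F z - cut n z))\<^sup>2) \<longlonglongrightarrow> 0"
      proof (intro AE_I2)
        fix z
        have "\<forall>\<^sub>F n in sequentially. (cmod (F z - cut n z))\<^sup>2 = 0"
        proof (cases "F z = 0")
          case False
          then obtain m where m: "inverse (real (Suc m)) < cmod (F z)"
            using reals_Archimedean[of "cmod (F z)"] by auto
          have "(cmod (F z - cut n z))\<^sup>2 = 0" if "m \<le> n" for n
          proof -
            have "1 / real (Suc n) \<le> 1 / real (Suc m)"
              using that by (intro divide_left_mono) auto
            then have "1 / real (Suc n) \<le> cmod (F z)"
              using m by (simp add: inverse_eq_divide)
            then show ?thesis by (simp add: cut_def)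
          qed
          then show ?thesis unfolding eventually_sequentially by blast
        qed (simp add: cut_def)
        then show "(\<lambda>n. (cmod (F z - cut n z))\<^sup>2) \<longlonglongrightarrow> 0"
          by (rule tendsto_eventually)
      qed
      show "AE z in M. norm ((cmod (F z - cut n z))\<^sup>2) \<le> (cmod (F z))\<^sup>2" for n
        by (auto simp: cut_def)
    qed measurable
    then show ?thesis by (simp add: energy_def)
  qed
  \<comment> \<open>The rate \<open>16^(- n)\<close> is the one that \<open>weak_limit_of_fast_Cauchy\<close> asks for.\<close>
  have "\<exists>m. energy M (\<lambda>z. F z - cut m z) \<le> 1 / 16 ^ n" for n
    using order_tendstoD(2)[OF cut_lim, of "1 / 16 ^ n"]
    by (auto simp: eventually_sequentially intro: less_imp_le)
  then obtain m where m: "\<And>n. energy M (\<lambda>z. F z - cut (m n) z) \<le> 1 / 16 ^ n"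
    by metis
  define H where "H n = cut (m n)" for n
  have H1: "integrable M (H n)" and H2: "square_integrable M (H n)" for n
    unfolding H_def by (rule cut1 cut2)+
  have HF: "energy M (\<lambda>z. F z - H n z) \<le> 1 / 16 ^ n" for n
    unfolding H_def by (rule m)
  have fast: "energy N (\<lambda>x. ker_adj (H (Suc n)) x - ker_adj (H n) x) \<le> (4 * A) / 16 ^ n" for n
  proof -
    \<comment> \<open>Both \<open>H n\<close> and \<open>H (n + 1)\<close> are close to \<open>F\<close>, hence to each other.\<close>
    have "energy N (\<lambda>x. ker_adj (H (Suc n)) x - ker_adj (H n) x) \<le>
        A * energy M (\<lambda>z. H (Suc n) z - H n z)"
      by (rule energy_ker_adj_diff_le[OF H1 H2 H1 H2])
    also have "energy M (\<lambda>z. H (Suc n) z - H n z) =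
        energy M (\<lambda>z. (F z - H n z) - (F z - H (Suc n) z))"
      by simp
    also have "\<dots> \<le> 2 * energy M (\<lambda>z. F z - H n z) + 2 * energy M (\<lambda>z. F z - H (Suc n) z)"
      by (intro energy_diff_le square_integrable_diff F H2)
    also have "\<dots> \<le> 4 / 16 ^ n"
    proof -
      have "1 / 16 ^ Suc n \<le> 1 / (16::real) ^ n"
        by (intro divide_left_mono) auto
      then show ?thesis using HF[of n] HF[of "Suc n"] by simp
    qed
    finally show ?thesis
      using A_nonneg by (simp add: mult_left_mono mult.commute[of 4])
  qed
  obtain g where g: "square_integrable N g"
    and lim: "\<And>f. square_integrable N f \<Longrightarrow>
      (\<lambda>n. \<integral>x. f x * cnj (ker_adj (H n) x) \<partial>N) \<longlonglongrightarrow> (\<integral>x. f x * cnj (g x) \<partial>N)"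
    using weak_limit_of_fast_Cauchy[OF square_integrable_ker_adj[OF H1] fast] by blast
  have "(\<integral>z. ker_op f z * cnj (F z) \<partial>M) = (\<integral>x. f x * cnj (g x) \<partial>N)"
    if f: "square_integrable N f" for f
  proof (rule LIMSEQ_unique)
    note op = square_integrable_ker_op[OF f]
    show "(\<lambda>n. \<integral>z. ker_op f z * cnj (H n z) \<partial>M) \<longlonglongrightarrow> (\<integral>x. f x * cnj (g x) \<partial>N)"
      unfolding pairing[OF f H1] by (rule lim[OF f])
    have "(\<lambda>n. (\<integral>z. ker_op f z * cnj (F z) \<partial>M) - (\<integral>z. ker_op f z * cnj (H n z) \<partial>M)) \<longlonglongrightarrow> 0"
    proof (rule Lim_null_comparison)
      have "cmod ((\<integral>z. ker_op f z * cnj (F z) \<partial>M) - (\<integral>z. ker_op f z * cnj (H n z) \<partial>M)) \<le>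
          sqrt (energy M (ker_op f) * (1 / 16 ^ n))" for n
      proof (rule real_le_rsqrt)
        have "(\<integral>z. ker_op f z * cnj (F z) \<partial>M) - (\<integral>z. ker_op f z * cnj (H n z) \<partial>M) =
            (\<integral>z. ker_op f z * cnj (F z) - ker_op f z * cnj (H n z) \<partial>M)"
          by (rule Bochner_Integration.integral_diff[symmetric])
            (intro integrable_mult_square_integrable op square_integrable_cnj F H2)+
        also have "\<dots> = (\<integral>z. ker_op f z * cnj (F z - H n z) \<partial>M)"
          by (simp add: right_diff_distrib)
        finally show "(cmod ((\<integral>z. ker_op f z * cnj (F z) \<partial>M) - (\<integral>z. ker_op f z * cnj (H n z) \<partial>M)))\<^sup>2 \<le>
            energy M (ker_op f) * (1 / 16 ^ n)"
          using Cauchy_Schwarz_integral[OF op square_integrable_cnj[OF square_integrable_diff[OF F H2]], of n]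
            mult_left_mono[OF HF[of n] energy_nonneg[of M "ker_op f"]]
          by (simp only: energy_cnj)
      qed
      then show "\<forall>\<^sub>F n in sequentially. norm ((\<integral>z. ker_op f z * cnj (F z) \<partial>M) - (\<integral>z. ker_op f z * cnj (H n z) \<partial>M)) \<le>
          sqrt (energy M (ker_op f) * (1 / 16 ^ n))" by simp
      have "(\<lambda>n. sqrt (energy M (ker_op f) * (1 / 16) ^ n)) \<longlonglongrightarrow> sqrt (energy M (ker_op f) * 0)"
        by (intro tendsto_intros LIMSEQ_realpow_zero) auto
      then show "(\<lambda>n. sqrt (energy M (ker_op f) * (1 / 16 ^ n))) \<longlonglongrightarrow> 0"
        by (simp add: power_divide)
    qed
    from tendsto_diff[OF tendsto_const[of "\<integral>z. ker_op f z * cnj (F z) \<partial>M"] this]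
    show "(\<lambda>n. \<integral>z. ker_op f z * cnj (H n z) \<partial>M) \<longlonglongrightarrow> (\<integral>z. ker_op f z * cnj (F z) \<partial>M)"
      by simp
  qed
  with g show ?thesis by blast
qed

end

section \<open>Lebesgue measure\<close>

lemma sigma_finite_lebesgue: "sigma_finite_measure (lebesgue :: 'a::euclidean_space measure)"
proof
  obtain A :: "'a set set" where A: "countable A" "A \<subseteq> sets lborel" "\<Union>A = space lborel"
      "\<And>a. a \<in> A \<Longrightarrow> emeasure lborel a \<noteq> \<infinity>"
    using lborel.sigma_finite_countable by metis
  then show "\<exists>A::'a set set. countable A \<and> A \<subseteq> sets lebesgue \<and> \<Union>A = space lebesgue \<and>
      (\<forall>a\<in>A. emeasure lebesgue a \<noteq> \<infinity>)"
    by (intro exI[of _ A]) auto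
qed

lemma measurable_continuous_pair_lebesgue:
  fixes f :: "'a::euclidean_space \<times> 'b::euclidean_space \<Rightarrow> complex"
  assumes "continuous_on UNIV f"
  shows "f \<in> borel_measurable (lebesgue \<Otimes>\<^sub>M lebesgue)"
proof -
  have id: "(\<lambda>x. x) \<in> measurable lebesgue (borel :: 'c::euclidean_space measure)"
    by (rule measurable_completion) simp
  have "(\<lambda>p. (fst p, snd p)) \<in> measurable (lebesgue \<Otimes>\<^sub>M lebesgue) (borel \<Otimes>\<^sub>M (borel :: 'b measure))"
    by (intro measurable_Pair measurable_compose[OF measurable_fst id] measurable_compose[OF measurable_snd id])
  moreover have "f \<in> borel_measurable (borel \<Otimes>\<^sub>M borel)"
    using borel_measurable_continuous_onI[OF assms] by (simp add: borel_prod)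
  ultimately show ?thesis
    by (auto dest: measurable_compose)
qed

section \<open>Gaussian integrals\<close>

text \<open>
  This is the characteristic function of the standard normal distribution without its normalisation.
\<close>

lemma std_normal_Fourier:
  "(\<integral>x. exp (complex_of_real (- x\<^sup>2 / 2) + \<i> * complex_of_real (t * x)) \<partial>lborel) =
    complex_of_real (sqrt (2 * pi)) * exp (complex_of_real (- t\<^sup>2 / 2))"
proof -
  have "complex_of_real (exp (- t\<^sup>2 / 2)) = (\<integral>x. std_normal_density x *\<^sub>R iexp (t * x) \<partial>lborel)"
    using fun_cong[OF char_std_normal_distribution, of t]
    by (simp add: char_def integral_density)
  also have "\<dots> = (\<integral>x. complex_of_real (1 / sqrt (2 * pi)) *
      exp (complex_of_real (- x\<^sup>2 / 2) + \<i> * complex_of_real (t * x)) \<partial>lborel)"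
    by (simp only: std_normal_density_def exp_add scaleR_conv_of_real of_real_mult mult.assoc exp_of_real)
  also have "\<dots> = complex_of_real (1 / sqrt (2 * pi)) *
      (\<integral>x. exp (complex_of_real (- x\<^sup>2 / 2) + \<i> * complex_of_real (t * x)) \<partial>lborel)"
    by (rule integral_mult_right_zero)
  finally have eq: "complex_of_real (exp (- t\<^sup>2 / 2)) = complex_of_real (1 / sqrt (2 * pi)) *
      (\<integral>x. exp (complex_of_real (- x\<^sup>2 / 2) + \<i> * complex_of_real (t * x)) \<partial>lborel)" .
  have solve: "I = complex_of_real r * u" if "u = complex_of_real (1 / r) * I" "r \<noteq> 0" for I u r
    using that by simp
  show ?thesis
    unfolding exp_of_real by (rule solve[OF eq]) simp
qed

text \<open>
  The substitution \<open>x = Re \<beta> / (2 \<gamma>) + \<sigma> y\<close> with \<open>\<sigma> = 1 / \<surd>(2 \<gamma>)\<close> completes the square in the real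
  part of the exponent and leaves the Fourier integral of \<open>exp (- y\<^sup>2 / 2)\<close> at the frequency
  \<open>\<sigma> Im \<beta>\<close>. Integrability comes for free:
  a Bochner integral with a value other than \<open>0\<close> has an integrable integrand.
\<close>

lemma
  fixes \<gamma> :: real and \<beta> :: complex
  assumes \<gamma>: "0 < \<gamma>"
  shows gaussian_integral: "(\<integral>x. exp (\<beta> * complex_of_real x - complex_of_real (\<gamma> * x\<^sup>2)) \<partial>lborel) =
      complex_of_real (sqrt (pi / \<gamma>)) * exp (\<beta>\<^sup>2 / complex_of_real (4 * \<gamma>))"
    and gaussian_integrable: "integrable lborel (\<lambda>x. exp (\<beta> * complex_of_real x - complex_of_real (\<gamma> * x\<^sup>2)))"
proof -
  define \<sigma> where "\<sigma> = 1 / sqrt (2 * \<gamma>)"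
  define u v where "u = Re \<beta>" and "v = Im \<beta>"
  have \<sigma>: "0 < \<sigma>" "\<sigma>\<^sup>2 = 1 / (2 * \<gamma>)"
    using \<gamma> by (auto simp: \<sigma>_def power_divide)
  have \<beta>: "\<beta> = complex_of_real u + \<i> * complex_of_real v"
    by (simp add: u_def v_def complex_eq)
  define E where "E = complex_of_real (u\<^sup>2 / (4 * \<gamma>)) + \<i> * complex_of_real (u * v / (2 * \<gamma>))"
  have expo: "\<beta> * complex_of_real (u / (2 * \<gamma>) + \<sigma> * y) - complex_of_real (\<gamma> * (u / (2 * \<gamma>) + \<sigma> * y)\<^sup>2) =
      E + (complex_of_real (- y\<^sup>2 / 2) + \<i> * complex_of_real (v * \<sigma> * y))" for y
  proof -
    have "\<gamma> * (u / (2 * \<gamma>) + \<sigma> * y)\<^sup>2 = u\<^sup>2 / (4 * \<gamma>) + u * \<sigma> * y + y\<^sup>2 / 2"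
      using \<gamma> \<sigma>(2) by (simp add: power2_sum power_mult_distrib) (simp add: field_simps power2_eq_square)
    then show ?thesis
      using \<gamma> unfolding \<beta> E_def
      by (simp add: complex_eq_iff field_simps power2_eq_square)
  qed
  have "(\<integral>x. exp (\<beta> * complex_of_real x - complex_of_real (\<gamma> * x\<^sup>2)) \<partial>lborel) =
      \<sigma> *\<^sub>R (\<integral>y. exp E * exp (complex_of_real (- y\<^sup>2 / 2) + \<i> * complex_of_real (v * \<sigma> * y)) \<partial>lborel)"
    using \<sigma>(1) by (subst lborel_integral_real_affine[of \<sigma> _ "u / (2 * \<gamma>)"]) (simp_all only: expo exp_add[of E] abs_of_pos)
  also have "\<dots> = complex_of_real \<sigma> * (exp E * (complex_of_real (sqrt (2 * pi)) * exp (complex_of_real (- (v * \<sigma>)\<^sup>2 / 2))))"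
    by (simp only: integral_mult_right_zero std_normal_Fourier scaleR_conv_of_real)
  also have "\<dots> = complex_of_real (\<sigma> * sqrt (2 * pi)) * exp (E + complex_of_real (- (v * \<sigma>)\<^sup>2 / 2))"
    by (simp only: exp_add of_real_mult mult_ac)
  also have "\<sigma> * sqrt (2 * pi) = sqrt (pi / \<gamma>)"
    using \<gamma> by (simp add: \<sigma>_def real_sqrt_mult real_sqrt_divide)
  also have "E + complex_of_real (- (v * \<sigma>)\<^sup>2 / 2) = \<beta>\<^sup>2 / complex_of_real (4 * \<gamma>)"
    using \<gamma> unfolding \<beta> E_def power_mult_distrib \<sigma>(2)
    by (simp add: field_simps power2_eq_square)
  finally show eq: "(\<integral>x. exp (\<beta> * complex_of_real x - complex_of_real (\<gamma> * x\<^sup>2)) \<partial>lborel) =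
      complex_of_real (sqrt (pi / \<gamma>)) * exp (\<beta>\<^sup>2 / complex_of_real (4 * \<gamma>))" .
  have "\<dots> \<noteq> 0" using \<gamma> by simp
  with eq show "integrable lborel (\<lambda>x. exp (\<beta> * complex_of_real x - complex_of_real (\<gamma> * x\<^sup>2)))"
    using not_integrable_integral_eq by fastforce
qed

lemma nn_integral_gaussian_real:
  fixes \<gamma> m :: real
  assumes \<gamma>: "0 < \<gamma>"
  shows "(\<integral>\<^sup>+x. ennreal (exp (- \<gamma> * (x - m)\<^sup>2)) \<partial>lborel) = ennreal (sqrt (pi / \<gamma>))"
proof -
  let ?g = "\<lambda>x. exp (complex_of_real (2 * \<gamma> * m) * complex_of_real x - complex_of_real (\<gamma> * x\<^sup>2))"
  have eq: "complex_of_real (exp (- \<gamma> * (x - m)\<^sup>2)) = complex_of_real (exp (- \<gamma> * m\<^sup>2)) * ?g x" for x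
    by (simp add: exp_of_real[symmetric] flip: exp_add) (simp add: algebra_simps power2_eq_square)
  have int: "integrable lborel (\<lambda>x. complex_of_real (exp (- \<gamma> * (x - m)\<^sup>2)))"
    unfolding eq by (intro integrable_mult_right gaussian_integrable \<gamma>)
  have "complex_of_real (\<integral>x. exp (- \<gamma> * (x - m)\<^sup>2) \<partial>lborel) = (\<integral>x. complex_of_real (exp (- \<gamma> * (x - m)\<^sup>2)) \<partial>lborel)"
    by (rule integral_complex_of_real[symmetric])
  also have "\<dots> = complex_of_real (exp (- \<gamma> * m\<^sup>2)) * (complex_of_real (sqrt (pi / \<gamma>)) *
      exp ((complex_of_real (2 * \<gamma> * m))\<^sup>2 / complex_of_real (4 * \<gamma>)))"
    unfolding eq integral_mult_right_zero gaussian_integral[OF \<gamma>] ..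
  also have "\<dots> = complex_of_real (sqrt (pi / \<gamma>)) *
      (exp (complex_of_real (- \<gamma> * m\<^sup>2)) * exp ((complex_of_real (2 * \<gamma> * m))\<^sup>2 / complex_of_real (4 * \<gamma>)))"
    by (simp only: exp_of_real mult_ac)
  also have "\<dots> = complex_of_real (sqrt (pi / \<gamma>))"
    using \<gamma> by (simp add: power2_eq_square flip: exp_add)
  finally have "(\<integral>x. exp (- \<gamma> * (x - m)\<^sup>2) \<partial>lborel) = sqrt (pi / \<gamma>)"
    by (simp only: of_real_eq_iff)
  moreover have "integrable lborel (\<lambda>x. exp (- \<gamma> * (x - m)\<^sup>2))"
    using integrable_Re[OF int] by simp
  ultimately show ?thesis
    by (simp add: nn_integral_eq_integral)
qed

lemma nn_integral_gaussian:
  fixes p :: "'a::euclidean_space"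
  assumes \<gamma>: "0 < \<gamma>"
  shows "(\<integral>\<^sup>+x. ennreal (exp (- \<gamma> * (norm (x - p))\<^sup>2)) \<partial>lborel) = ennreal (sqrt (pi / \<gamma>) ^ DIM('a))"
proof -
  have "- \<gamma> * (norm (x - p))\<^sup>2 = (\<Sum>b\<in>Basis. - \<gamma> * (x \<bullet> b - p \<bullet> b)\<^sup>2)" for x
    unfolding power2_norm_eq_inner euclidean_inner[of "x - p" "x - p"]
    by (simp add: inner_diff_left power2_eq_square sum_distrib_left sum_negf)
  then have "(\<integral>\<^sup>+x. ennreal (exp (- \<gamma> * (norm (x - p))\<^sup>2)) \<partial>lborel) =
      (\<integral>\<^sup>+x. (\<Prod>b\<in>Basis. ennreal (exp (- \<gamma> * (x \<bullet> b - p \<bullet> b)\<^sup>2))) \<partial>lborel)"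
    by (simp add: exp_sum prod_ennreal)
  also have "\<dots> = (\<Prod>b\<in>Basis. (\<integral>\<^sup>+x. ennreal (exp (- \<gamma> * (x - p \<bullet> b)\<^sup>2)) \<partial>lborel))"
    by (rule nn_integral_lborel_prod[of "\<lambda>b x. ennreal (exp (- \<gamma> * (x - p \<bullet> b)\<^sup>2))"]) auto
  also have "\<dots> = ennreal (sqrt (pi / \<gamma>) ^ DIM('a))"
    unfolding nn_integral_gaussian_real[OF \<gamma>] using \<gamma> by (simp add: ennreal_power)
  finally show ?thesis .
qed

section \<open>The pairing of two phase functions\<close>

text \<open>
  In the sum of the two exponents the terms in \<open>x\<^sup>2\<close> add up to \<open>\<i> (c - cnj c) / 2 = - Im c\<close> times \<open>x\<^sup>2\<close>,
  and the linear coefficient is \<open>\<i> (b z - cnj (b \<zeta>))\<close>.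
\<close>

lemma
  assumes c: "0 < Im c"
  shows phase_pairing: "(\<integral>x. exp (\<i> * phase a b c z x) * cnj (exp (\<i> * phase a b c \<zeta> x)) \<partial>lebesgue) =
      complex_of_real (sqrt (pi / Im c)) *
      exp (\<i> * a * z\<^sup>2 / 2 - \<i> * cnj a * (cnj \<zeta>)\<^sup>2 / 2 - (b * z - cnj (b * \<zeta>))\<^sup>2 / complex_of_real (4 * Im c))"
    and integrable_phase_pairing:
      "integrable lebesgue (\<lambda>x. exp (\<i> * phase a b c z x) * cnj (exp (\<i> * phase a b c \<zeta> x)))"
proof -
  define P where "P = \<i> * a * z\<^sup>2 / 2 - \<i> * cnj a * (cnj \<zeta>)\<^sup>2 / 2"
  define \<beta> where "\<beta> = \<i> * (b * z - cnj (b * \<zeta>))"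
  let ?g = "\<lambda>x. exp (\<beta> * complex_of_real x - complex_of_real (Im c * x\<^sup>2))"
  have "\<i> * phase a b c z x + cnj (\<i> * phase a b c \<zeta> x) = P + (\<beta> * complex_of_real x - complex_of_real (Im c * x\<^sup>2))" for x
  proof -
    have "\<i> * (c - cnj c) = - 2 * complex_of_real (Im c)"
      by (simp add: complex_eq_iff)
    moreover have "\<i> * phase a b c z x + cnj (\<i> * phase a b c \<zeta> x) =
        P + (\<beta> * complex_of_real x + \<i> * (c - cnj c) / 2 * (complex_of_real x)\<^sup>2)"
      by (simp add: phase_def P_def \<beta>_def field_simps)
    ultimately show ?thesis by simp
  qed
  then have eq: "exp (\<i> * phase a b c z x) * cnj (exp (\<i> * phase a b c \<zeta> x)) = exp P * ?g x" for x
    by (simp only: exp_cnj flip: exp_add)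
  have g: "?g \<in> borel_measurable lborel"
    by measurable
  show "integrable lebesgue (\<lambda>x. exp (\<i> * phase a b c z x) * cnj (exp (\<i> * phase a b c \<zeta> x)))"
    unfolding eq using gaussian_integrable[OF c, of \<beta>]
    by (intro integrable_mult_right) (simp only: integrable_completion[OF g])
  have "(\<integral>x. exp (\<i> * phase a b c z x) * cnj (exp (\<i> * phase a b c \<zeta> x)) \<partial>lebesgue) =
      exp P * (complex_of_real (sqrt (pi / Im c)) * exp (\<beta>\<^sup>2 / complex_of_real (4 * Im c)))"
    unfolding eq integral_mult_right_zero integral_completion[OF g] gaussian_integral[OF c] ..
  also have "\<dots> = complex_of_real (sqrt (pi / Im c)) * exp (P + \<beta>\<^sup>2 / complex_of_real (4 * Im c))"
    by (simp only: exp_add mult_ac)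
  finally show "(\<integral>x. exp (\<i> * phase a b c z x) * cnj (exp (\<i> * phase a b c \<zeta> x)) \<partial>lebesgue) =
      complex_of_real (sqrt (pi / Im c)) *
      exp (\<i> * a * z\<^sup>2 / 2 - \<i> * cnj a * (cnj \<zeta>)\<^sup>2 / 2 - (b * z - cnj (b * \<zeta>))\<^sup>2 / complex_of_real (4 * Im c))"
    by (simp add: P_def \<beta>_def power_mult_distrib)
qed

lemma C_phase_normalisation:
  assumes c: "0 < Im c"
  shows "(C_phase b c)\<^sup>2 * sqrt (pi / Im c) = (cmod b)\<^sup>2 / (2 * pi * Im c)"
proof -
  have "(C_phase b c)\<^sup>2 = 2 powr (- 1) * pi powr (- 3 / 2) * (cmod b)\<^sup>2 * Im c powr (- 1 / 2)"
  proof -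
    have "(r powr - (1 / 4))\<^sup>2 = r powr - (1 / 2)" for r :: real
      by (simp add: power2_eq_square flip: powr_add)
    then show ?thesis by (simp add: C_phase_def power_mult_distrib powr_power)
  qed
  also have "\<dots> * sqrt (pi / Im c) =
      2 powr (- 1) * (pi powr (- 3 / 2) * pi powr (1 / 2)) * (cmod b)\<^sup>2 * (Im c powr (- 1 / 2) * Im c powr (- 1 / 2))"
  proof -
    have "sqrt (pi / Im c) = pi powr (1 / 2) * Im c powr (- 1 / 2)"
      using c by (simp add: real_sqrt_divide powr_half_sqrt powr_minus_divide)
    then show ?thesis by (simp only: mult_ac)
  qed
  also have "\<dots> = 2 powr (- 1) * pi powr (- 1) * (cmod b)\<^sup>2 * Im c powr (- 1)"
    unfolding powr_add[symmetric] by simp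
  also have "\<dots> = (cmod b)\<^sup>2 / (2 * pi * Im c)"
    using c by (simp add: powr_minus_divide)
  finally show ?thesis .
qed

section \<open>The Bargmann transform as an unweighted kernel operator\<close>

text \<open>
  The parameters of a transform whose weight \<open>exp (- 2 \<Phi>)\<close> is the weight of \<open>X_space s\<close>.
\<close>

locale bargmann_parameters =
  fixes s :: real and a b c :: complex
  assumes s: "0 < s" "s < 1" and c: "Im c > 0"
    and cmod_b: "(1 - s\<^sup>2) / (4 * s) = (cmod b)\<^sup>2 / (4 * Im c)"
    and b_sq: "complex_of_real ((1 + s\<^sup>2) / (4 * s)) = b\<^sup>2 / complex_of_real (4 * Im c) + a / (2 * \<i>)"
begin

definition \<alpha> :: real where "\<alpha> = (1 - s\<^sup>2) / (2 * s)"
definition \<beta> :: real where "\<beta> = (1 + s\<^sup>2) / (4 * s)"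

lemma \<alpha>_pos: "0 < \<alpha>"
  using s by (simp add: \<alpha>_def power_less_one_iff abs_square_less_1)

lemma cmod_b_eq: "(cmod b)\<^sup>2 = 2 * Im c * \<alpha>"
  using cmod_b c s by (simp add: \<alpha>_def field_simps)

lemma b_cnj_b: "b * cnj b = complex_of_real (2 * Im c * \<alpha>)"
  by (simp add: complex_norm_square[symmetric] flip: cmod_b_eq)

lemma b_sq_eq: "b\<^sup>2 = 4 * complex_of_real (Im c) * (complex_of_real \<beta> + \<i> * a / 2)"
proof -
  have "a / (2 * \<i>) = - (\<i> * a / 2)"
    by (simp add: field_simps)
  then have "b\<^sup>2 / (4 * complex_of_real (Im c)) = complex_of_real \<beta> + \<i> * a / 2"
    using b_sq by (simp add: \<beta>_def)
  then show ?thesis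
    using c by (simp add: divide_eq_eq mult.commute)
qed

lemma cnj_b_sq_eq: "(cnj b)\<^sup>2 = 4 * complex_of_real (Im c) * (complex_of_real \<beta> - \<i> * cnj a / 2)"
  using arg_cong[OF b_sq_eq, of cnj] by simp

text \<open>
  In \<open>2 \<Phi>\<close> the coefficient of \<open>z\<^sup>2\<close> is \<open>- (b\<^sup>2 / (4 Im c) + a / (2 \<i>))\<close>, which is \<open>- \<beta>\<close> by assumption; the
  coefficient of \<open>(cnj z)\<^sup>2\<close> is its conjugate.
\<close>

lemma Phi_eq: "2 * Phi a b c z = \<alpha> * (cmod z)\<^sup>2 - \<beta> * Re (z\<^sup>2 + (cnj z)\<^sup>2)"
proof -
  have re: "complex_of_real (Re (z\<^sup>2 + (cnj z)\<^sup>2)) = z\<^sup>2 + (cnj z)\<^sup>2"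
    by (simp add: complex_eq_iff power2_eq_square)
  have quad: "(b\<^sup>2 * z\<^sup>2 + (cnj b)\<^sup>2 * (cnj z)\<^sup>2) / complex_of_real (8 * Im c) =
      complex_of_real \<beta> * (z\<^sup>2 + (cnj z)\<^sup>2) / 2 - (a * z\<^sup>2 - cnj a * (cnj z)\<^sup>2) / (4 * \<i>)"
    using c unfolding b_sq_eq cnj_b_sq_eq by (simp add: field_simps)
  have circ: "(cmod (b * z))\<^sup>2 / (4 * Im c) = \<alpha> * (cmod z)\<^sup>2 / 2"
    using c by (simp add: norm_mult power_mult_distrib cmod_b_eq)
  have "complex_of_real (Phi a b c z) = complex_of_real (\<alpha> * (cmod z)\<^sup>2 / 2) - complex_of_real \<beta> * (z\<^sup>2 + (cnj z)\<^sup>2) / 2"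
    unfolding of_real_Phi quad circ by simp
  then have "complex_of_real (2 * Phi a b c z) =
      complex_of_real (\<alpha> * (cmod z)\<^sup>2 - \<beta> * Re (z\<^sup>2 + (cnj z)\<^sup>2))"
    unfolding of_real_mult[of 2] of_real_diff of_real_mult[of \<beta>] re by simp
  then show ?thesis by (simp only: of_real_eq_iff)
qed

lemma Phi_weight_eq: "Phi_weight a b c = X_weight s"
proof
  fix z
  have "X_weight s z = exp (- (\<alpha> * (cmod z)\<^sup>2 - \<beta> * Re (z\<^sup>2 + (cnj z)\<^sup>2)))"
    unfolding X_weight_def \<beta>_def minus_divide_left[symmetric] \<alpha>_def[symmetric] by simp
  then show "Phi_weight a b c z = X_weight s z"
    unfolding Phi_eq[symmetric] by (simp add: Phi_weight_def)
qed

text \<open>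
  Expanding \<open>(b z - cnj (b \<zeta>))\<^sup>2 / (4 Im c)\<close> in the exponent of the pairing, the square terms combine
  with those of the phase to \<open>- \<beta> (z\<^sup>2 + (cnj \<zeta>)\<^sup>2)\<close>, as in \<open>\<Phi>\<close>, and the mixed term carries
  \<open>\<bar>b\<bar>\<^sup>2 / (2 Im c) = \<alpha>\<close>.
\<close>

lemma K_kernel_eq_phase_pairing:
  "complex_of_real ((C_phase b c)\<^sup>2) *
    (\<integral>x. exp (\<i> * phase a b c z x) * cnj (exp (\<i> * phase a b c \<zeta> x)) \<partial>lebesgue) = K_kernel s z \<zeta>"
proof -
  have "(b * z - cnj (b * \<zeta>))\<^sup>2 = b\<^sup>2 * z\<^sup>2 - 2 * (b * cnj b) * z * cnj \<zeta> + (cnj b)\<^sup>2 * (cnj \<zeta>)\<^sup>2"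
    by (simp add: power2_eq_square algebra_simps)
  also have "\<dots> / complex_of_real (4 * Im c) = (complex_of_real \<beta> + \<i> * a / 2) * z\<^sup>2
      - complex_of_real \<alpha> * z * cnj \<zeta> + (complex_of_real \<beta> - \<i> * cnj a / 2) * (cnj \<zeta>)\<^sup>2"
    using c unfolding b_sq_eq cnj_b_sq_eq b_cnj_b by (simp add: field_simps)
  finally have expo: "\<i> * a * z\<^sup>2 / 2 - \<i> * cnj a * (cnj \<zeta>)\<^sup>2 / 2 - (b * z - cnj (b * \<zeta>))\<^sup>2 / complex_of_real (4 * Im c) =
      complex_of_real \<alpha> * z * cnj \<zeta> - complex_of_real \<beta> * (z\<^sup>2 + (cnj \<zeta>)\<^sup>2)"
    by (simp add: algebra_simps)
  have "(C_phase b c)\<^sup>2 * sqrt (pi / Im c) = \<alpha> / pi"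
    using c by (simp add: C_phase_normalisation cmod_b_eq)
  also have "\<dots> = (1 - s\<^sup>2) / (2 * pi * s)"
    by (simp add: \<alpha>_def)
  finally have "complex_of_real ((C_phase b c)\<^sup>2) * complex_of_real (sqrt (pi / Im c)) =
      complex_of_real ((1 - s\<^sup>2) / (2 * pi * s))"
    by (simp only: of_real_mult[symmetric])
  then show ?thesis
    unfolding phase_pairing[OF c] expo K_kernel_def mult.assoc[symmetric]
    by (simp add: \<alpha>_def \<beta>_def)
qed

text \<open>
  The factor \<open>exp (- \<Phi> z)\<close> moves half of the weight into the kernel, the other half goes to the
  function that it is paired with. This replaces the weighted space by the \<open>L\<^sup>2\<close> space of Lebesgue
  measure.
\<close>

definition unweighted_kernel :: "complex \<Rightarrow> real \<Rightarrow> complex" where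
  "unweighted_kernel z x = complex_of_real (C_phase b c * exp (- Phi a b c z)) * exp (\<i> * phase a b c z x)"

lemma continuous_on_Phi: "continuous_on UNIV (Phi a b c)"
  unfolding Phi_def using c by (intro continuous_intros) auto

lemma unweighted_gram:
  "(\<integral>x. unweighted_kernel z x * cnj (unweighted_kernel \<zeta> x) \<partial>lebesgue) =
    K_kernel s z \<zeta> * complex_of_real (exp (- Phi a b c z)) * complex_of_real (exp (- Phi a b c \<zeta>))"
proof -
  have "unweighted_kernel z x * cnj (unweighted_kernel \<zeta> x) =
      complex_of_real ((C_phase b c)\<^sup>2 * exp (- Phi a b c z) * exp (- Phi a b c \<zeta>)) *
      (exp (\<i> * phase a b c z x) * cnj (exp (\<i> * phase a b c \<zeta> x)))" for x
    by (simp add: unweighted_kernel_def power2_eq_square)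
  then have "(\<integral>x. unweighted_kernel z x * cnj (unweighted_kernel \<zeta> x) \<partial>lebesgue) =
      complex_of_real ((C_phase b c)\<^sup>2 * exp (- Phi a b c z) * exp (- Phi a b c \<zeta>)) *
      (\<integral>x. exp (\<i> * phase a b c z x) * cnj (exp (\<i> * phase a b c \<zeta> x)) \<partial>lebesgue)"
    by (simp only: integral_mult_right_zero)
  then show ?thesis
    unfolding K_kernel_eq_phase_pairing[symmetric] by (simp only: of_real_mult mult_ac)
qed

text \<open>
  The quadratic terms of \<open>K_kernel\<close> cancel against those of \<open>\<Phi>\<close>, and \<open>\<alpha> Re (z cnj \<zeta>)\<close> completes
  \<open>- \<alpha> (\<bar>z\<bar>\<^sup>2 + \<bar>\<zeta>\<bar>\<^sup>2) / 2\<close> to a square.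
\<close>

lemma cmod_unweighted_gram:
  "cmod (\<integral>x. unweighted_kernel z x * cnj (unweighted_kernel \<zeta> x) \<partial>lebesgue) =
    \<alpha> / pi * exp (- (\<alpha> / 2) * (cmod (\<zeta> - z))\<^sup>2)"
proof -
  have "cmod (K_kernel s z \<zeta>) = \<alpha> / pi * exp (\<alpha> * Re (z * cnj \<zeta>) - \<beta> * Re (z\<^sup>2 + (cnj \<zeta>)\<^sup>2))"
  proof -
    have "K_kernel s z \<zeta> = complex_of_real (\<alpha> / pi) *
        exp (complex_of_real \<alpha> * (z * cnj \<zeta>) - complex_of_real \<beta> * (z\<^sup>2 + (cnj \<zeta>)\<^sup>2))"
      by (simp add: K_kernel_def \<alpha>_def \<beta>_def mult_ac)
    then show ?thesis
      using \<alpha>_pos by (simp only: norm_mult norm_of_real norm_exp_eq_Re) simp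
  qed
  moreover have "cmod (\<integral>x. unweighted_kernel z x * cnj (unweighted_kernel \<zeta> x) \<partial>lebesgue) =
      cmod (K_kernel s z \<zeta>) * exp (- Phi a b c z) * exp (- Phi a b c \<zeta>)"
    unfolding unweighted_gram by (simp only: norm_mult norm_of_real abs_exp_cancel)
  ultimately have "cmod (\<integral>x. unweighted_kernel z x * cnj (unweighted_kernel \<zeta> x) \<partial>lebesgue) =
      \<alpha> / pi * exp (\<alpha> * Re (z * cnj \<zeta>) - \<beta> * Re (z\<^sup>2 + (cnj \<zeta>)\<^sup>2) - Phi a b c z - Phi a b c \<zeta>)"
    by (simp only: diff_conv_add_uminus exp_add mult.assoc)
  also have "\<alpha> * Re (z * cnj \<zeta>) - \<beta> * Re (z\<^sup>2 + (cnj \<zeta>)\<^sup>2) - Phi a b c z - Phi a b c \<zeta> =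
      - (\<alpha> / 2) * (cmod (\<zeta> - z))\<^sup>2"
    using Phi_eq[of z] Phi_eq[of \<zeta>] unfolding cmod_power2
    by (simp add: power2_eq_square algebra_simps)
  finally show ?thesis .
qed

lemma square_integrable_unweighted_kernel: "square_integrable lebesgue (unweighted_kernel z)"
proof -
  have "integrable lebesgue (\<lambda>x. (cmod (unweighted_kernel z x))\<^sup>2)"
    using integrable_mult_right[OF integrable_norm[OF integrable_phase_pairing[OF c, of a b z z]],
        of "(C_phase b c * exp (- Phi a b c z))\<^sup>2"]
    by (simp add: unweighted_kernel_def norm_mult power_mult_distrib power2_eq_square abs_mult mult_ac)
  moreover have "unweighted_kernel z \<in> borel_measurable lborel"
    unfolding unweighted_kernel_def phase_def by measurable
  ultimately show ?thesis
    by (simp add: square_integrable_def measurable_completion)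
qed

text \<open>
  The constant \<open>2\<close> is the integral of \<open>(\<alpha> / \<pi>) exp (- \<alpha> \<bar>\<zeta>\<bar>\<^sup>2 / 2)\<close> over the plane.
\<close>

sublocale schur_kernel lebesgue lebesgue unweighted_kernel 2 "\<alpha> / pi"
proof (intro schur_kernel.intro pair_sigma_finite.intro sigma_finite_lebesgue schur_kernel_axioms.intro)
  have "continuous_on UNIV (\<lambda>p. unweighted_kernel (fst p) (snd p))"
    unfolding unweighted_kernel_def phase_def
    by (intro continuous_intros continuous_on_compose2[OF continuous_on_Phi]) auto
  then show "case_prod unweighted_kernel \<in> borel_measurable (lebesgue \<Otimes>\<^sub>M lebesgue)"
    using measurable_continuous_pair_lebesgue by (simp add: case_prod_beta')
  fix z :: complex
  show "square_integrable lebesgue (unweighted_kernel z)"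
    by (rule square_integrable_unweighted_kernel)
  have "energy lebesgue (unweighted_kernel z) =
      cmod (\<integral>x. unweighted_kernel z x * cnj (unweighted_kernel z x) \<partial>lebesgue)"
    by (simp add: integral_mult_cnj_self)
  then show "energy lebesgue (unweighted_kernel z) \<le> \<alpha> / pi"
    by (simp add: cmod_unweighted_gram)
  have "(\<integral>\<^sup>+\<zeta>. ennreal (cmod (\<integral>x. unweighted_kernel z x * cnj (unweighted_kernel \<zeta> x) \<partial>lebesgue)) \<partial>lebesgue) =
      (\<integral>\<^sup>+\<zeta>. ennreal (\<alpha> / pi) * ennreal (exp (- (\<alpha> / 2) * (cmod (\<zeta> - z))\<^sup>2)) \<partial>lborel)"
    unfolding cmod_unweighted_gram using \<alpha>_pos by (simp only: nn_integral_completion ennreal_mult' divide_nonneg_pos pi_gt_zero less_imp_le)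
  also have "\<dots> = ennreal (\<alpha> / pi) * ennreal (sqrt (pi / (\<alpha> / 2)) ^ 2)"
    using nn_integral_gaussian[of "\<alpha> / 2" z] \<alpha>_pos by (subst nn_integral_cmult) auto
  also have "\<dots> = ennreal 2"
    using \<alpha>_pos by (simp flip: ennreal_mult)
  finally show "(\<integral>\<^sup>+\<zeta>. ennreal (cmod (\<integral>x. unweighted_kernel z x * cnj (unweighted_kernel \<zeta> x) \<partial>lebesgue)) \<partial>lebesgue) \<le>
      ennreal 2" by simp
qed (use \<alpha>_pos in auto)

lemma ker_op_eq_bargmann: "ker_op f z = complex_of_real (exp (- Phi a b c z)) * bargmann a b c f z"
proof -
  have "ker_op f z = (\<integral>x. complex_of_real (C_phase b c * exp (- Phi a b c z)) * (exp (\<i> * phase a b c z x) * f x) \<partial>lebesgue)"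
    by (simp add: ker_op_def unweighted_kernel_def mult.assoc)
  also have "\<dots> = complex_of_real (C_phase b c * exp (- Phi a b c z)) * (\<integral>x. exp (\<i> * phase a b c z x) * f x \<partial>lebesgue)"
    by (rule integral_mult_right_zero)
  finally show ?thesis by (simp add: bargmann_def mult_ac)
qed

lemma Phi_weight_eq_sq: "Phi_weight a b c z = exp (- Phi a b c z) * exp (- Phi a b c z)"
  by (simp add: Phi_weight_def flip: exp_add)

lemma L2_real_iff: "f \<in> L2_real \<longleftrightarrow> square_integrable lebesgue f"
  by (simp add: L2_real_def L2w_def square_integrable_def)

lemma square_integrable_unweight:
  assumes "F \<in> L2_Phi a b c"
  shows "square_integrable lebesgue (\<lambda>z. F z * complex_of_real (exp (- Phi a b c z)))"
proof -
  have [measurable]: "Phi a b c \<in> borel_measurable lebesgue" "F \<in> borel_measurable lebesgue"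
    using assms by (auto intro!: measurable_completion borel_measurable_continuous_onI continuous_on_Phi
        simp: L2_Phi_def L2w_def)
  have "(\<lambda>z. F z * complex_of_real (exp (- Phi a b c z))) \<in> borel_measurable lebesgue"
    by measurable
  with assms show ?thesis
    by (simp add: square_integrable_def L2_Phi_def L2w_def norm_mult power_mult_distrib
        Phi_weight_eq_sq power2_eq_square mult_ac)
qed

lemma Phi_inner_bargmann:
  "Phi_inner a b c (bargmann a b c f) F =
    (\<integral>z. ker_op f z * cnj (F z * complex_of_real (exp (- Phi a b c z))) \<partial>lebesgue)"
  by (simp add: Phi_inner_def innerw_def ker_op_eq_bargmann Phi_weight_eq_sq mult_ac)

lemma bargmann_adj_correct:
  assumes F: "F \<in> L2_Phi a b c"
  shows "bargmann_adj a b c F \<in> L2_real"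
    and "f \<in> L2_real \<Longrightarrow> Phi_inner a b c (bargmann a b c f) F = inner_real f (bargmann_adj a b c F)"
proof -
  have "\<exists>g. g \<in> L2_real \<and> (\<forall>f\<in>L2_real. Phi_inner a b c (bargmann a b c f) F = inner_real f g)"
    using adjoint_exists[OF square_integrable_unweight[OF F]]
    by (simp add: L2_real_iff Phi_inner_bargmann inner_real_def innerw_def Ball_def)
  from someI_ex[OF this]
  show "bargmann_adj a b c F \<in> L2_real"
    and "f \<in> L2_real \<Longrightarrow> Phi_inner a b c (bargmann a b c f) F = inner_real f (bargmann_adj a b c F)"
    by (auto simp: bargmann_adj_def)
qed

lemma
  assumes F: "F \<in> L2_Phi a b c"
  shows integrable_K_kernel:
      "integrable lebesgue (\<lambda>\<zeta>. K_kernel s z \<zeta> * F \<zeta> * complex_of_real (X_weight s \<zeta>))"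
    and bargmann_bargmann_adj: "bargmann a b c (bargmann_adj a b c F) z =
      (\<integral>\<zeta>. K_kernel s z \<zeta> * F \<zeta> * complex_of_real (X_weight s \<zeta>) \<partial>lebesgue)"
proof -
  let ?F = "\<lambda>z. F z * complex_of_real (exp (- Phi a b c z))"
  let ?e = "complex_of_real (exp (- Phi a b c z))"
  have gram: "gram z \<zeta> * ?F \<zeta> = ?e * (K_kernel s z \<zeta> * F \<zeta> * complex_of_real (X_weight s \<zeta>))" for \<zeta>
    unfolding gram_def unweighted_gram Phi_weight_eq[symmetric] Phi_weight_eq_sq
    by (simp only: of_real_mult mult_ac)
  show "integrable lebesgue (\<lambda>\<zeta>. K_kernel s z \<zeta> * F \<zeta> * complex_of_real (X_weight s \<zeta>))"
  proof -
    have cancel: "inverse ?e * (?e * w) = w" for w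
      by simp
    show ?thesis
      using integrable_mult_right[OF integrable_gram_mult[OF square_integrable_unweight[OF F], of z],
          of "inverse ?e"]
      unfolding gram cancel by simp
  qed
  have "ker_op (bargmann_adj a b c F) z = (\<integral>\<zeta>. gram z \<zeta> * ?F \<zeta> \<partial>lebesgue)"
    using bargmann_adj_correct(2)[OF F]
    by (intro ker_op_eq_gram_integral)
      (simp_all add: L2_real_iff Phi_inner_bargmann inner_real_def innerw_def)
  then show "bargmann a b c (bargmann_adj a b c F) z =
      (\<integral>\<zeta>. K_kernel s z \<zeta> * F \<zeta> * complex_of_real (X_weight s \<zeta>) \<partial>lebesgue)"
    unfolding gram ker_op_eq_bargmann integral_mult_right_zero by simp
qed

end

section \<open>The composition of the transform with its adjoint\<close>

theorem theorem4:
  fixes s :: real and a b c :: complex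
  assumes "0 < s" and "s < 1"
    and "b \<noteq> 0" and "Im c > 0"
    and "(1 - s\<^sup>2) / (4 * s) = (cmod b)\<^sup>2 / (4 * Im c)"
    and "complex_of_real ((1 + s\<^sup>2) / (4 * s)) = b\<^sup>2 / complex_of_real (4 * Im c) + a / (2 * \<i>)"
  shows "X_space s = H_Phi a b c
    \<and> (\<forall>\<phi>\<in>X_space s. \<forall>\<psi>\<in>X_space s. X_inner s \<phi> \<psi> = Phi_inner a b c \<phi> \<psi>)
    \<and> (\<forall>F\<in>L2_Phi a b c. \<forall>z.
         integrable lebesgue (\<lambda>\<zeta>. K_kernel s z \<zeta> * F \<zeta> * complex_of_real (X_weight s \<zeta>))
         \<and> (bargmann a b c \<circ> bargmann_adj a b c) F z
             = (\<integral>\<zeta>. K_kernel s z \<zeta> * F \<zeta> * complex_of_real (X_weight s \<zeta>) \<partial>lebesgue))"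
proof -
  interpret bargmann_parameters s a b c
    by unfold_locales fact+
  show ?thesis
    by (simp add: X_space_def H_Phi_def L2_Phi_def X_inner_def Phi_inner_def Phi_weight_eq
        integrable_K_kernel[unfolded L2_Phi_def Phi_weight_eq] bargmann_bargmann_adj[unfolded L2_Phi_def Phi_weight_eq])
qed

end
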